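(* Let $\varphi$ be a four-dimensional nilpotent complex Jordan algebra. If $\varphi$ is not Abelian, then $\varphi$ is isomorphic to one of the following pairwise non-isomorphic algebras on $\mathbb{C}^4$ with basis $\{e_1,e_2,e_3,e_4\}$, whose characteristic sequence $s$, orbit dimension $\dim\mathcal{O}$ and center dimension $\dim Z$ are given by the triple $(s;\dim\mathcal{O};\dim Z)$: \begin{itemize} \item $\varphi_1$: $\varphi_1(e_1,e_1)=e_2$, $\varphi_1(e_1,e_2)=e_3$, $\varphi_1(e_1,e_3)=e_4$, $\varphi_1(e_2,e_2)=e_4$; $((4);12;1)$. \item $\varphi_2$: $\varphi_2(e_1,e_1)=e_2$, $\varphi_2(e_1,e_2)=e_3$, $\varphi_2(e_4,e_4)=e_2$; $((3,1);13;1)$. \item $\varphi_3$: $\varphi_3(e_1,e_1)=e_2$, $\varphi_3(e_1,e_2)=e_3$, $\varphi_3(e_2,e_4)=e_3$, $\varphi_3(e_4,e_4)=-e_2-e_3$; $((3,1);12;1)$. \item $\varphi_4$: $\varphi_4(e_1,e_1)=e_2$, $\varphi_4(e_1,e_2)=e_3$, $\varphi_4(e_2,e_4)=e_3$, $\varphi_4(e_4,e_4)=-e_2$; $((3,1);11;1)$. \item $\varphi_5$: $\varphi_5(e_1,e_1)=e_2$, $\varphi_5(e_1,e_2)=e_3$, $\varphi_5(e_2,e_4)=e_3$; $((3,1);12;1)$. \item $\varphi_6$: $\varphi_6(e_1,e_1)=e_2$, $\varphi_6(e_1,e_2)=e_3$, $\varphi_6(e_4,e_4)=e_3$; $((3,1);11;1)$.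 \item $\varphi_7$: $\varphi_7(e_1,e_1)=e_2$, $\varphi_7(e_1,e_2)=e_3$; $((3,1);10;2)$. \item $\varphi_8$: $\varphi_8(e_1,e_1)=e_2$, $\varphi_8(e_3,e_3)=e_4$; $((2,2);10;2)$. \item $\varphi_9$: $\varphi_9(e_1,e_1)=e_2$, $\varphi_9(e_1,e_3)=e_4$; $((2,2);9;2)$. \item $\varphi_{10}$: $\varphi_{10}(e_1,e_1)=e_2$, $\varphi_{10}(e_3,e_4)=e_2$; $((2,1,1);9;1)$. \item $\varphi_{11}$: $\varphi_{11}(e_1,e_1)=e_2$, $\varphi_{11}(e_3,e_3)=e_2$; $((2,1,1);8;2)$. \item $\varphi_{12}$: $\varphi_{12}(e_1,e_1)=e_2$; $((2,1,1);6;3)$. \end{itemize}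
   Context: A complex Jordan algebra $J=(V,\varphi)$ is a complex vector space $V$ with a symmetric bilinear map $\varphi:V\times V\to V$ satisfying $\varphi(\varphi(x,x),\varphi(x,y))=\varphi(x,\varphi(\varphi(x,x),y))$ for all $x,y\in V$. It is Abelian if $\varphi\equiv 0$. Put $\mathcal{C}^1(J)=J$ and $\mathcal{C}^{m+1}(J)=\varphi(\mathcal{C}^m(J),J)$ (linear span of products); $J$ is nilpotent if $\mathcal{C}^k(J)=\{0\}$ for some $k$. The center is $Z(\varphi)=\{x\in V:\varphi(x,y)=0\ \forall y\in V\}$. In listing an algebra, all products of basis vectors not listed (and not obtained from listed ones by symmetry) are zero. Characteristic sequence: for $x\in V$ let $L_x(y)=\varphi(x,y)$, a nilpotent endomorphism when $J$ is nilpotent. For non-zero $x\in J-\mathcal{C}^2(J)$, $s_\varphi(x)$ is the descending sequence of dimensions of the Jordan blocks of $L_x$; $s(\varphi)$ is the least upper bound, for the lexicographic order, of $\{s_\varphi(x):x\in J-\mathcal{C}^2(J)\}$. Orbit: $\mathcal{O}(\varphi)$ is the orbit of $\varphi$ under the action of $GL(n,\mathbb{C})$ on nilpotent Jordan algebra laws on $\mathbb{C}^n$ (here $n=4$), $(f\cdot\varphi)(x,y)=f^{-1}(\varphi(f(x),f(y)))$. Its dimension $\dim\mathcal{O}(\varphi)$ is the vector space dimension of its tangent space at $\varphi$, which consists of the maps $\delta_\varphi f(x,y)=\varphi(f(x),y)+\varphi(x,f(y))-f(\varphi(x,y))$, $f$ a linear endomorphism of $\mathbb{C}^n$. *)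

theory Defs
  imports
    "HOL-Analysis.Analysis"
    "HOL-Library.Function_Algebras"
    "HOL-Library.List_Lexorder"
    "HOL-Library.Lub_Glb"
    "Jordan_Normal_Form.Jordan_Normal_Form"
begin

no_notation Matrix.vec_index (infixl \<open>$\<close> 100)

section \<open>Jordan algebras on a complex vector space\<close>

text \<open>
  The underlying space is the whole type \<^typ>\<open>'v\<close> with a scalar multiplication
  \<open>smul\<close>; the standard instance is \<open>complex ^ 4\<close> with \<open>(*s)\<close>.
  Linearity in the second argument and commutativity give bilinearity.
\<close>

locale jordan_algebra = vector_space smul
  for smul :: "complex \<Rightarrow> 'v::ab_group_add \<Rightarrow> 'v" +
  fixes \<phi> :: "'v \<Rightarrow> 'v \<Rightarrow> 'v"
  assumes linear_right: "Vector_Spaces.linear smul smul (\<phi> x)"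
    and commute: "\<phi> x y = \<phi> y x"
    and jordan: "\<phi> (\<phi> x x) (\<phi> x y) = \<phi> x (\<phi> (\<phi> x x) y)"

definition abelian :: "('v::ab_group_add \<Rightarrow> 'v \<Rightarrow> 'v) \<Rightarrow> bool" where
  "abelian \<phi> \<longleftrightarrow> (\<forall>x y. \<phi> x y = 0)"

text \<open>
  The descending central sequence is indexed from 1 (\<open>\<C>\<^sup>1 = V\<close>); the value at 0 is a dummy value.
\<close>

fun central_seq ::
  "(complex \<Rightarrow> 'v::ab_group_add \<Rightarrow> 'v) \<Rightarrow> ('v \<Rightarrow> 'v \<Rightarrow> 'v) \<Rightarrow> nat \<Rightarrow> 'v set" where
  "central_seq smul \<phi> 0 = UNIV"
| "central_seq smul \<phi> (Suc 0) = UNIV"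
| "central_seq smul \<phi> (Suc (Suc m)) =
     Modules.module.span smul {\<phi> x y | x y. x \<in> central_seq smul \<phi> (Suc m)}"

definition nilpotent_jordan_algebra ::
  "(complex \<Rightarrow> 'v::ab_group_add \<Rightarrow> 'v) \<Rightarrow> ('v \<Rightarrow> 'v \<Rightarrow> 'v) \<Rightarrow> bool" where
  "nilpotent_jordan_algebra smul \<phi> \<longleftrightarrow>
     jordan_algebra smul \<phi> \<and> (\<exists>k\<ge>1. central_seq smul \<phi> k = {0})"

definition center :: "('v::ab_group_add \<Rightarrow> 'v \<Rightarrow> 'v) \<Rightarrow> 'v set" where
  "center \<phi> = {x. \<forall>y. \<phi> x y = 0}"

definition isomorphic_algebras ::
  "(complex \<Rightarrow> 'v::ab_group_add \<Rightarrow> 'v) \<Rightarrow> ('v \<Rightarrow> 'v \<Rightarrow> 'v) \<Rightarrow>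
   (complex \<Rightarrow> 'w::ab_group_add \<Rightarrow> 'w) \<Rightarrow> ('w \<Rightarrow> 'w \<Rightarrow> 'w) \<Rightarrow> bool" where
  "isomorphic_algebras smul \<phi> smul' \<psi> \<longleftrightarrow>
     (\<exists>f. Vector_Spaces.linear smul smul' f \<and> bij f \<and> (\<forall>x y. f (\<phi> x y) = \<psi> (f x) (f y)))"


section \<open>Characteristic sequence of a law on \<open>complex ^ 4\<close>\<close>

type_synonym law4 = "complex ^ 4 \<Rightarrow> complex ^ 4 \<Rightarrow> complex ^ 4"

text \<open>
  Numerals of type \<^typ>\<open>4\<close> are read modulo 4 (so \<open>4 = 0\<close>), and \<open>1, 2, 3, 4\<close> are its four
  elements.
\<close>

definition e :: "4 \<Rightarrow> complex ^ 4" where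
  "e i = axis i 1"

text \<open>
  The matrix with respect to \<open>e 1, e 2, e 3, e 4\<close>, as a matrix of the
  Jordan normal form library, whose indices start at 0.
\<close>

definition matrix4 :: "(complex ^ 4 \<Rightarrow> complex ^ 4) \<Rightarrow> complex mat" where
  "matrix4 f = Matrix.mat 4 4 (\<lambda>(i, j). f (e (of_nat (Suc j))) $ of_nat (Suc i))"

text \<open>
  A Jordan normal form is a list of pairs (block size, eigenvalue). As the order of the blocks
  is immaterial, sorting the sizes makes \<open>s\<close> unique for given \<open>x\<close>.
\<close>

definition jordan_sizes_at :: "law4 \<Rightarrow> complex ^ 4 \<Rightarrow> nat list \<Rightarrow> bool" where
  "jordan_sizes_at \<phi> x s \<longleftrightarrow>
     (\<exists>n_as. jordan_nf (matrix4 (\<phi> x)) n_as \<and> s = rev (sort (map fst n_as)))"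

text \<open>
  The order on \<^typ>\<open>nat list\<close> is the lexicographic one. It is total, so that taking upper bounds
  among all lists or only among the partitions of 4 makes no difference.
\<close>

definition has_char_seq :: "law4 \<Rightarrow> nat list \<Rightarrow> bool" where
  "has_char_seq \<phi> s \<longleftrightarrow>
     isLub UNIV
       {s'. \<exists>x. x \<noteq> 0 \<and> x \<notin> central_seq (*s) \<phi> 2 \<and> jordan_sizes_at \<phi> x s'} s"


section \<open>Orbits of laws on \<open>complex ^ 4\<close>\<close>

definition law_action :: "(complex ^ 4 \<Rightarrow> complex ^ 4) \<Rightarrow> law4 \<Rightarrow> law4" where
  "law_action f \<phi> = (\<lambda>x y. inv_into UNIV f (\<phi> (f x) (f y)))"

definition orbit :: "law4 \<Rightarrow> law4 set" where
  "orbit \<phi> = {law_action f \<phi> | f. Vector_Spaces.linear (*s) (*s) f \<and> bij f}"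

definition delta :: "law4 \<Rightarrow> (complex ^ 4 \<Rightarrow> complex ^ 4) \<Rightarrow> law4" where
  "delta \<phi> f = (\<lambda>x y. \<phi> (f x) y + \<phi> x (f y) - f (\<phi> x y))"

text \<open>The tangent space of \<^term>\<open>orbit \<phi>\<close> at \<open>\<phi>\<close>; see \<open>delta_velocity\<close> below.\<close>

definition orbit_tangent_space :: "law4 \<Rightarrow> law4 set" where
  "orbit_tangent_space \<phi> = {delta \<phi> f | f. Vector_Spaces.linear (*s) (*s) f}"

text \<open>Dimension over the complex numbers, for the pointwise vector space structure on laws.\<close>

definition dim_orbit :: "law4 \<Rightarrow> nat" where
  "dim_orbit \<phi> =
     vector_space.dim (\<lambda>c \<psi> x y. c *s \<psi> x y) (orbit_tangent_space \<phi>)"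


section \<open>The twelve laws\<close>

text \<open>
  The commutative bilinear extension of a list of products of basis vectors: an entry
  \<open>((i, j), v)\<close> stands for \<open>\<phi>(e\<^sub>i, e\<^sub>j) = \<phi>(e\<^sub>j, e\<^sub>i) = v\<close>, and products without an entry are zero.
\<close>

definition basis_product :: "((4 \<times> 4) \<times> (complex ^ 4)) list \<Rightarrow> 4 \<Rightarrow> 4 \<Rightarrow> complex ^ 4" where
  "basis_product T i j =
     (case map_of T (i, j) of
        Some v \<Rightarrow> v
      | None \<Rightarrow> (case map_of T (j, i) of Some v \<Rightarrow> v | None \<Rightarrow> 0))"

definition law :: "((4 \<times> 4) \<times> (complex ^ 4)) list \<Rightarrow> law4" where
  "law T = (\<lambda>x y. \<Sum>i\<in>UNIV. \<Sum>j\<in>UNIV. (x $ i * y $ j) *s basis_product T i j)"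

text \<open>Only the indices from 1 to 12 are meaningful.\<close>

definition phi :: "nat \<Rightarrow> law4" where
  "phi n = law ([
     \<comment> \<open>1\<close>  [((1, 1), e 2), ((1, 2), e 3), ((1, 3), e 4), ((2, 2), e 4)],
     \<comment> \<open>2\<close>  [((1, 1), e 2), ((1, 2), e 3), ((4, 4), e 2)],
     \<comment> \<open>3\<close>  [((1, 1), e 2), ((1, 2), e 3), ((2, 4), e 3), ((4, 4), - e 2 - e 3)],
     \<comment> \<open>4\<close>  [((1, 1), e 2), ((1, 2), e 3), ((2, 4), e 3), ((4, 4), - e 2)],
     \<comment> \<open>5\<close>  [((1, 1), e 2), ((1, 2), e 3), ((2, 4), e 3)],
     \<comment> \<open>6\<close>  [((1, 1), e 2), ((1, 2), e 3), ((4, 4), e 3)],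
     \<comment> \<open>7\<close>  [((1, 1), e 2), ((1, 2), e 3)],
     \<comment> \<open>8\<close>  [((1, 1), e 2), ((3, 3), e 4)],
     \<comment> \<open>9\<close>  [((1, 1), e 2), ((1, 3), e 4)],
     \<comment> \<open>10\<close> [((1, 1), e 2), ((3, 4), e 2)],
     \<comment> \<open>11\<close> [((1, 1), e 2), ((3, 3), e 2)],
     \<comment> \<open>12\<close> [((1, 1), e 2)]] ! (n - 1))"


section \<open>Tangent vectors of the orbit\<close>

text \<open>
  \<^term>\<open>delta \<phi> f\<close> is the velocity at \<open>t = 0\<close> of the curve \<open>(id + t f) \<cdot> \<phi>\<close> in the orbit
  (\<open>id + t f\<close> is invertible for small \<open>t\<close>).
\<close>

lemma norm_vector_smult: "norm (c *s x) = norm c * norm (x :: complex ^ 'n)"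
  by (simp add: norm_vec_def norm_mult L2_set_right_distrib)

lemma smult_scaleR: "complex_of_real r *s (x :: complex ^ 'n) = r *\<^sub>R x"
  unfolding Finite_Cartesian_Product.vec_eq_iff
  by (simp add: scaleR_conv_of_real[where 'a = complex])

lemma complex_linear_bounded:
  fixes f :: "complex ^ 'n \<Rightarrow> complex ^ 'm"
  assumes "Vector_Spaces.linear (*s) (*s) f"
  shows "bounded_linear f"
proof -
  interpret Vector_Spaces.linear "(*s)" "(*s)" f by fact
  have "linear f"
    by (rule linearI) (simp_all add: add flip: smult_scaleR, simp add: scale)
  then show ?thesis
    by (simp add: linear_conv_bounded_linear)
qed

lemma delta_velocity:
  assumes f: "Vector_Spaces.linear (*s) (*s) f"
    and right: "\<And>x. Vector_Spaces.linear (*s) (*s) (\<phi> x)"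
    and left: "\<And>y. Vector_Spaces.linear (*s) (*s) (\<lambda>x. \<phi> x y)"
  shows "((\<lambda>t. inverse t *s (law_action (\<lambda>z. z + t *s f z) \<phi> x y - \<phi> x y))
            \<longlongrightarrow> delta \<phi> f x y) (at 0)"
    and "\<forall>\<^sub>F t in at 0. law_action (\<lambda>z. z + t *s f z) \<phi> \<in> orbit \<phi>"
proof -
  interpret f: Vector_Spaces.linear "(*s)" "(*s)" f by fact
  interpret R: Vector_Spaces.linear "(*s)" "(*s)" "\<phi> x" for x by fact
  interpret L: Vector_Spaces.linear "(*s)" "(*s)" "\<lambda>x. \<phi> x y" for y by fact
  obtain K where K: "K > 0" "\<And>z. norm (f z) \<le> norm z * K"
    using bounded_linear.pos_bounded[OF complex_linear_bounded[OF f]] by blast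
  define g where "g t z = z + t *s f z" for t z
  have small: "\<forall>\<^sub>F t in at (0::complex). norm t * K \<le> 1 / 2 \<and> t \<noteq> 0"
  proof -
    have "((\<lambda>t::complex. norm t * K) \<longlongrightarrow> norm (0::complex) * K) (at 0)"
      by (intro tendsto_intros)
    then have "\<forall>\<^sub>F t in at (0::complex). norm t * K < 1 / 2"
      by (rule order_tendstoD) simp
    moreover have "\<forall>\<^sub>F t in at (0::complex). t \<noteq> 0"
      by (simp add: eventually_at_filter)
    ultimately show ?thesis
      by eventually_elim auto
  qed
  have lin: "Vector_Spaces.linear (*s) (*s) (g t)" for t
    unfolding g_def
    by unfold_locales
      (simp_all add: f.add f.scale vector_add_ldistrib vector_smult_assoc mult.commute)
  have lower: "norm z \<le> 2 * norm (g t z)" if "norm t * K \<le> 1 / 2" for t z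
  proof -
    have "norm z = norm (g t z - t *s f z)"
      by (simp add: g_def)
    also have "\<dots> \<le> norm (g t z) + norm t * norm (f z)"
      by (metis norm_triangle_ineq4 norm_vector_smult)
    also have "norm t * norm (f z) \<le> norm t * (norm z * K)"
      by (intro mult_left_mono K) simp
    also have "\<dots> \<le> 1 / 2 * norm z"
      using mult_right_mono[OF that norm_ge_zero[of z]] by (simp add: mult_ac)
    finally show ?thesis
      by simp
  qed
  have bij: "bij (g t)" if "norm t * K \<le> 1 / 2" for t
  proof -
    interpret g: Vector_Spaces.linear "(*s)" "(*s)" "g t" by (rule lin)
    have "inj (g t)"
    proof (rule injI)
      fix a b
      assume "g t a = g t b"
      then show "a = b"
        using lower[OF that, of "a - b"] by (simp add: g.diff)
    qed
    then show ?thesis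
      using vec.linear_inj_imp_surj[OF lin] by (simp add: bij_def)
  qed
  show "\<forall>\<^sub>F t in at 0. law_action (\<lambda>z. z + t *s f z) \<phi> \<in> orbit \<phi>"
    using small
  proof eventually_elim
    case (elim t)
    then show ?case
      using lin[of t] bij[of t] unfolding orbit_def g_def by blast
  qed
  define B where "B = \<phi> (f x) (f y)"
  define D where "D = delta \<phi> f x y"
  define w where "w t = law_action (g t) \<phi> x y - \<phi> x y" for t
  have w: "w t + t *s f (w t) = t *s (D + t *s B)" if "norm t * K \<le> 1 / 2" for t
  proof -
    have "g t (w t + \<phi> x y) = \<phi> (g t x) (g t y)"
      using bij[OF that] by (simp add: w_def law_action_def bij_is_surj surj_f_inv_f)
    then show ?thesis
      unfolding g_def D_def B_def delta_def
      by (simp add: f.add f.scale R.add R.scale L.add L.scale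
          vector_add_ldistrib vector_ssub_ldistrib vector_smult_assoc algebra_simps)
  qed
  have bound: "norm (inverse t *s w t - D)
      \<le> norm t * norm B + K * (2 * (norm t * (norm D + norm t * norm B)))"
    if "norm t * K \<le> 1 / 2" "t \<noteq> 0" for t
  proof -
    have "inverse t *s (w t + t *s f (w t)) = D + t *s B"
      using that by (simp add: w vector_smult_assoc)
    then have "inverse t *s w t - D = t *s B - f (w t)"
      using that by (simp add: vector_add_ldistrib vector_smult_assoc algebra_simps)
    then have "norm (inverse t *s w t - D) \<le> norm t * norm B + norm (f (w t))"
      by (metis norm_triangle_ineq4 norm_vector_smult)
    also have "norm (f (w t)) \<le> K * norm (w t)"
      using K(2)[of "w t"] by (simp add: mult.commute)
    also have "norm (w t) \<le> 2 * norm (t *s (D + t *s B))"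
      using lower[OF that(1), of "w t"] w[OF that(1)] by (simp add: g_def)
    also have "norm (t *s (D + t *s B)) \<le> norm t * (norm D + norm t * norm B)"
      unfolding norm_vector_smult
      by (intro mult_left_mono) (metis norm_triangle_ineq norm_vector_smult, simp)
    finally show ?thesis
      using K(1) by simp
  qed
  have "((\<lambda>t. inverse t *s w t - D) \<longlongrightarrow> 0) (at 0)"
  proof (rule Lim_null_comparison)
    show "\<forall>\<^sub>F t in at 0. norm (inverse t *s w t - D)
        \<le> norm t * norm B + K * (2 * (norm t * (norm D + norm t * norm B)))"
      using small by eventually_elim (use bound in blast)
    show "((\<lambda>t::complex. norm t * norm B + K * (2 * (norm t * (norm D + norm t * norm B))))
        \<longlongrightarrow> 0) (at 0)"
      by (auto intro!: tendsto_eq_intros)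
  qed
  then show "((\<lambda>t. inverse t *s (law_action (\<lambda>z. z + t *s f z) \<phi> x y - \<phi> x y))
      \<longlongrightarrow> delta \<phi> f x y) (at 0)"
    by (simp add: Lim_null[symmetric] w_def g_def[abs_def] D_def)
qed

end

theory Submission
  imports Defs
begin

text \<open>
  The classification rests on a flag. In a nilpotent algebra every proper subspace \<open>W\<close> admits a
  vector \<open>b \<notin> W\<close> whose products all lie in \<open>W\<close>: take \<open>b\<close> in the last term of the descending central
  sequence that is not contained in \<open>W\<close>. Applying this to \<open>0\<close> and to the spans so obtained gives a
  basis \<open>b\<^sub>1, b\<^sub>2, b\<^sub>3, b\<^sub>4\<close> such that all products with \<open>b\<^sub>i\<close> lie in the span of the later vectors. A
  commutative law is then described by ten complex numbers (\<open>nilpotent_triangular_model\<close>), and the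
  rest of the classification is a finite case distinction with explicit changes of basis.

  \<^item> If \<open>b\<^sub>1b\<^sub>1\<close> has a component along \<open>b\<^sub>2\<close>, take it as the new \<open>b\<^sub>2\<close>. If then \<open>b\<^sub>1b\<^sub>2\<close> has a
    component along \<open>b\<^sub>3\<close>, the Jordan identity leaves only the algebra \<open>\<phi>\<^sub>1\<close> generated by one element
    and \<open>\<phi>\<^sub>7\<close>. Otherwise all products other than \<open>b\<^sub>1b\<^sub>1\<close> lie on the line of \<open>b\<^sub>4\<close>; these laws form the
    family of \<open>classified_family\<close>, which consists of \<open>\<phi>\<^sub>5, \<phi>\<^sub>6, \<phi>\<^sub>7, \<phi>\<^sub>8, \<phi>\<^sub>9, \<phi>\<^sub>1\<^sub>2\<close>.
  \<^item> If all products lie on the line of \<open>b\<^sub>4\<close>, the law is a symmetric bilinear form on a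
    three-dimensional space, and its rank \<open>1, 2, 3\<close> gives \<open>\<phi>\<^sub>1\<^sub>2, \<phi>\<^sub>1\<^sub>1, \<phi>\<^sub>1\<^sub>0\<close>.
  \<^item> Otherwise the products of \<open>b\<^sub>1\<close> and \<open>b\<^sub>2\<close> define, modulo \<open>b\<^sub>4\<close>, a nonzero binary quadratic form.
    Rank one leads back to the family above. For rank two normalize it to \<open>x\<^sup>2 + y\<^sup>2\<close>;
    multiplication by the square of \<open>b\<^sub>1\<close> is a linear form \<open>(f, g)\<close> with values on the line of \<open>b\<^sub>4\<close>.
    It is nonisotropic for \<open>\<phi>\<^sub>2\<close>, isotropic and nonzero for \<open>\<phi>\<^sub>3\<close> and \<open>\<phi>\<^sub>4\<close>, and if it vanishes, the two
    components of the product form a pencil of binary quadratic forms, which either contains only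
    one form up to scaling (\<open>\<phi>\<^sub>1\<^sub>1\<close>) or has a singular member and so is covered by the family.

  The tangent space of an orbit is the image of the matrices under \<open>M \<mapsto> \<delta>\<^sub>\<phi> M\<close>, whose kernel consists
  of the derivations. Hence the orbit dimension is 16 minus the number of free entries of a
  derivation, and each value follows from writing the derivations of the law in solved form
  (\<open>dim_orbit_derivations\<close>).

  For the characteristic sequences, \<open>L\<^sub>x\<close> with \<open>x = e\<^sub>1\<close> (or \<open>x = e\<^sub>1 + e\<^sub>3\<close> for \<open>\<phi>\<^sub>8\<close>) is already a Jordan
  matrix up to a permutation of the basis. That no \<open>x\<close> does better follows for each law from an
  identity: \<open>L\<^sub>x\<^sup>k = 0\<close> bounds the block sizes by \<open>k\<close>, and rank at most one excludes two blocks of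
  size 2.

  Orbit dimension and dimension of the center are isomorphism invariants and separate all but five
  pairs of laws. These are separated by the vanishing of all products of three or of four factors
  and by whether the vectors with central square are closed under addition.
\<close>

(* Without this the simplifier turns phi 1 into phi (Suc 0). *)
declare One_nat_def [simp del]

section \<open>The twelve laws in coordinates\<close>

lemma vector_4 [simp]:
  fixes w x y z :: "'a::zero"
  shows "(vector [w, x, y, z] :: 'a ^ 4) $ 1 = w" "(vector [w, x, y, z] :: 'a ^ 4) $ 2 = x"
    "(vector [w, x, y, z] :: 'a ^ 4) $ 3 = y" "(vector [w, x, y, z] :: 'a ^ 4) $ 4 = z"
  by (simp_all add: vector_def)

lemma vec4_eq_iff:
  fixes x y :: "'a ^ 4"
  shows "x = y \<longleftrightarrow> x $ 1 = y $ 1 \<and> x $ 2 = y $ 2 \<and> x $ 3 = y $ 3 \<and> x $ 4 = y $ 4"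
  by (simp add: Finite_Cartesian_Product.vec_eq_iff forall_4)

lemma e_components [simp]: "e i $ j = (if i = j then 1 else 0)"
  by (simp add: e_def axis_def)

lemma phi_components:
  fixes x y :: "complex ^ 4"
  shows
    "phi 1 x y = vector [0, x $ 1 * y $ 1, x $ 1 * y $ 2 + x $ 2 * y $ 1,
      x $ 1 * y $ 3 + x $ 3 * y $ 1 + x $ 2 * y $ 2]"
    "phi 2 x y = vector [0, x $ 1 * y $ 1 + x $ 4 * y $ 4, x $ 1 * y $ 2 + x $ 2 * y $ 1, 0]"
    "phi 3 x y = vector [0, x $ 1 * y $ 1 - x $ 4 * y $ 4,
      x $ 1 * y $ 2 + x $ 2 * y $ 1 + x $ 2 * y $ 4 + x $ 4 * y $ 2 - x $ 4 * y $ 4, 0]"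
    "phi 4 x y = vector [0, x $ 1 * y $ 1 - x $ 4 * y $ 4,
      x $ 1 * y $ 2 + x $ 2 * y $ 1 + x $ 2 * y $ 4 + x $ 4 * y $ 2, 0]"
    "phi 5 x y = vector [0, x $ 1 * y $ 1, x $ 1 * y $ 2 + x $ 2 * y $ 1 + x $ 2 * y $ 4 + x $ 4 * y $ 2, 0]"
    "phi 6 x y = vector [0, x $ 1 * y $ 1, x $ 1 * y $ 2 + x $ 2 * y $ 1 + x $ 4 * y $ 4, 0]"
    "phi 7 x y = vector [0, x $ 1 * y $ 1, x $ 1 * y $ 2 + x $ 2 * y $ 1, 0]"
    "phi 8 x y = vector [0, x $ 1 * y $ 1, 0, x $ 3 * y $ 3]"
    "phi 9 x y = vector [0, x $ 1 * y $ 1, 0, x $ 1 * y $ 3 + x $ 3 * y $ 1]"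
    "phi 10 x y = vector [0, x $ 1 * y $ 1 + x $ 3 * y $ 4 + x $ 4 * y $ 3, 0, 0]"
    "phi 11 x y = vector [0, x $ 1 * y $ 1 + x $ 3 * y $ 3, 0, 0]"
    "phi 12 x y = vector [0, x $ 1 * y $ 1, 0, 0]"
  unfolding phi_def law_def basis_product_def
  by (simp_all add: vec4_eq_iff sum_4)

lemma index_cases:
  assumes "i \<in> {1..12::nat}"
  shows "i = 1 \<or> i = 2 \<or> i = 3 \<or> i = 4 \<or> i = 5 \<or> i = 6 \<or> i = 7 \<or> i = 8 \<or> i = 9
    \<or> i = 10 \<or> i = 11 \<or> i = 12"
  using assms unfolding atLeastAtMost_iff by presburger

lemma index_induct [consumes 1, case_names 1 2 3 4 5 6 7 8 9 10 11 12]: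
  assumes "i \<in> {1..12::nat}"
    and "P 1" "P 2" "P 3" "P 4" "P 5" "P 6" "P 7" "P 8" "P 9" "P 10" "P 11" "P 12"
  shows "P i"
  using index_cases[OF assms(1)] assms(2-) by (elim disjE) (simp_all only:)

lemma phi_linear: "Vector_Spaces.linear (*s) (*s) (phi n x)"
  unfolding phi_def law_def
  by unfold_locales
    (simp_all add: vec4_eq_iff sum_4 algebra_simps)

lemma phi_commute: "i \<in> {1..12} \<Longrightarrow> phi i x y = phi i y x"
  by (induction i rule: index_induct)
    (simp_all add: phi_components vec4_eq_iff mult.commute add.commute)

lemma phi_jordan: "i \<in> {1..12} \<Longrightarrow> phi i (phi i x x) (phi i x y) = phi i x (phi i (phi i x x) y)"
  by (induction i rule: index_induct)
    (simp_all add: phi_components vec4_eq_iff algebra_simps)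

lemma phi_jordan_algebra: "i \<in> {1..12} \<Longrightarrow> jordan_algebra (*s) (phi i)"
  using phi_linear phi_commute phi_jordan
  by (auto simp: jordan_algebra_def jordan_algebra_axioms_def vec.vector_space_axioms)

section \<open>Nilpotency\<close>

text \<open>
  The ascending central series, with the center as term 1.
\<close>

primrec upper_central :: "('v::ab_group_add \<Rightarrow> 'v \<Rightarrow> 'v) \<Rightarrow> nat \<Rightarrow> 'v set" where
  "upper_central \<phi> 0 = {0}"
| "upper_central \<phi> (Suc k) = {u. \<forall>y. \<phi> u y \<in> upper_central \<phi> k}"

context jordan_algebra
begin

lemma right_add: "\<phi> x (y + z) = \<phi> x y + \<phi> x z"
proof -
  interpret Vector_Spaces.linear smul smul "\<phi> x" by (rule linear_right)
  show ?thesis by (rule add)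
qed

lemma right_scale: "\<phi> x (smul c y) = smul c (\<phi> x y)"
proof -
  interpret Vector_Spaces.linear smul smul "\<phi> x" by (rule linear_right)
  show ?thesis by (rule scale)
qed

lemma right_zero [simp]: "\<phi> x 0 = 0"
proof -
  interpret Vector_Spaces.linear smul smul "\<phi> x" by (rule linear_right)
  show ?thesis by (rule zero)
qed

lemma left_add: "\<phi> (x + y) z = \<phi> x z + \<phi> y z"
  using right_add[of z x y] by (simp add: commute)

lemma left_scale: "\<phi> (smul c x) y = smul c (\<phi> x y)"
  using right_scale[of y c x] by (simp add: commute)

lemma left_zero [simp]: "\<phi> 0 y = 0"
  using right_zero[of y] by (simp add: commute)

lemmas product_simps = right_add right_scale left_add left_scale

lemma subspace_upper_central: "subspace (upper_central \<phi> k)"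
proof (induction k)
  case (Suc k)
  show ?case
    unfolding subspace_def
    by (auto simp: product_simps subspace_add[OF Suc] subspace_scale[OF Suc] subspace_0[OF Suc])
qed simp

lemma central_seq_Suc_subset:
  assumes "subspace S" "\<And>x y. x \<in> central_seq smul \<phi> (Suc m) \<Longrightarrow> \<phi> x y \<in> S"
  shows "central_seq smul \<phi> (Suc (Suc m)) \<subseteq> S"
proof -
  have "span {\<phi> x y | x y. x \<in> central_seq smul \<phi> (Suc m)} \<subseteq> S"
    by (rule span_minimal) (use assms in auto)
  then show ?thesis by simp
qed

lemma subspace_central_seq: "subspace (central_seq smul \<phi> m)"
  by (cases "(smul, \<phi>, m)" rule: central_seq.cases) auto

text \<open>
  The descending series drops by at least one step of the ascending one each time. This makes
  nilpotency of a concrete law a plain identity: all sufficiently long products vanish.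
\<close>

lemma central_seq_eq_zero:
  assumes "upper_central \<phi> k = UNIV"
  shows "central_seq smul \<phi> (Suc k) = {0}"
proof -
  have "central_seq smul \<phi> (Suc j) \<subseteq> upper_central \<phi> (k - j)" if "j \<le> k" for j
    using that
  proof (induction j)
    case (Suc j)
    then have "central_seq smul \<phi> (Suc j) \<subseteq> upper_central \<phi> (Suc (k - Suc j))"
      by (simp add: Suc_diff_Suc del: upper_central.simps)
    then show ?case
      by (intro central_seq_Suc_subset subspace_upper_central) auto
  qed (use assms in simp)
  from this[of k] have "central_seq smul \<phi> (Suc k) \<subseteq> {0}"
    by simp
  moreover have "0 \<in> central_seq smul \<phi> (Suc k)"
    using subspace_central_seq by (rule subspace_0)
  ultimately show ?thesis
    by auto
qed

end

lemma phi_nilpotent: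
  assumes i: "i \<in> {1..12}"
  shows "nilpotent_jordan_algebra (*s) (phi i)"
proof -
  have "upper_central (phi i) (Suc (Suc (Suc (Suc 0)))) = UNIV"
    using i by (induction i rule: index_induct)
      (auto simp: phi_components vec4_eq_iff)
  then have "central_seq (*s) (phi i) (Suc (Suc (Suc (Suc (Suc 0))))) = {0}"
    using jordan_algebra.central_seq_eq_zero[OF phi_jordan_algebra[OF i]] by blast
  then show ?thesis
    unfolding nilpotent_jordan_algebra_def
    using phi_jordan_algebra[OF i] le_add1[of 1] by (metis plus_1_eq_Suc)
qed

lemma phi_not_abelian:
  assumes "i \<in> {1..12}"
  shows "\<not> abelian (phi i)"
proof -
  have "phi i (e 1) (e 1) $ 2 = 1"
    using assms by (induction i rule: index_induct) (simp_all add: phi_components)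
  then have "phi i (e 1) (e 1) \<noteq> 0"
    by auto
  then show ?thesis
    unfolding abelian_def by blast
qed

section \<open>Isomorphisms and bases\<close>

definition comm_bilinear :: "law4 \<Rightarrow> bool" where
  "comm_bilinear \<psi> \<longleftrightarrow> (\<forall>x. Vector_Spaces.linear (*s) (*s) (\<psi> x)) \<and> (\<forall>x y. \<psi> x y = \<psi> y x)"

lemma jordan_algebra_comm_bilinear: "jordan_algebra (*s) \<psi> \<Longrightarrow> comm_bilinear \<psi>"
  unfolding comm_bilinear_def jordan_algebra_def jordan_algebra_axioms_def by blast

lemma comm_bilinear_simps:
  assumes "comm_bilinear \<psi>"
  shows "\<psi> x (y + z) = \<psi> x y + \<psi> x z" "\<psi> x (c *s y) = c *s \<psi> x y"
    "\<psi> (x + y) z = \<psi> x z + \<psi> y z" "\<psi> (c *s x) y = c *s \<psi> x y"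
    "\<psi> x (sum g A) = (\<Sum>a\<in>A. \<psi> x (g a))" "\<psi> (sum g A) y = (\<Sum>a\<in>A. \<psi> (g a) y)"
proof -
  interpret R: Vector_Spaces.linear "(*s)" "(*s)" "\<psi> x" for x
    using assms by (simp add: comm_bilinear_def)
  have comm: "\<psi> x y = \<psi> y x" for x y
    using assms by (simp add: comm_bilinear_def)
  show "\<psi> x (y + z) = \<psi> x y + \<psi> x z" "\<psi> x (c *s y) = c *s \<psi> x y"
    "\<psi> x (sum g A) = (\<Sum>a\<in>A. \<psi> x (g a))"
    by (rule R.add R.scale R.sum)+
  show "\<psi> (x + y) z = \<psi> x z + \<psi> y z" "\<psi> (c *s x) y = c *s \<psi> x y"
    "\<psi> (sum g A) y = (\<Sum>a\<in>A. \<psi> (g a) y)"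
    by (simp_all only: comm[of "x + y"] comm[of x z] comm[of y z] comm[of "c *s x"] comm[of x y]
        comm[of "sum g A"] comm[of "g _" y] R.add R.scale R.sum)
qed

lemma vec4_expansion: "x = (\<Sum>i\<in>UNIV. x $ i *s e i)"
  by (simp add: vec4_eq_iff sum_4)

lemma comm_bilinear_expand:
  assumes "comm_bilinear \<psi>"
  shows "\<psi> (\<Sum>i\<in>UNIV. x $ i *s p i) (\<Sum>j\<in>UNIV. y $ j *s p j)
    = (\<Sum>i\<in>UNIV. \<Sum>j\<in>UNIV. (x $ i * y $ j) *s \<psi> (p i) (p j))"
  by (subst comm_bilinear_simps(6)[OF assms])
    (simp add: comm_bilinear_simps[OF assms] vec.scale_sum_right vector_smult_assoc mult.commute)

lemma isomorphic_algebras_sym: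
  assumes "isomorphic_algebras smul \<phi> smul' \<psi>"
  shows "isomorphic_algebras smul' \<psi> smul \<phi>"
proof -
  obtain f where f: "Vector_Spaces.linear smul smul' f" "bij f" "\<And>x y. f (\<phi> x y) = \<psi> (f x) (f y)"
    using assms unfolding isomorphic_algebras_def by blast
  interpret Vector_Spaces.linear smul smul' f by (rule f(1))
  have "Vector_Spaces.linear smul' smul (inv_into UNIV f)"
    using module_hom_axioms bij_module_hom_imp_inv_module_hom f(2) vs1.vector_space_axioms vs2.vector_space_axioms
    by (auto simp: Vector_Spaces.linear_def)
  moreover have "inv_into UNIV f (\<psi> x y) = \<phi> (inv_into UNIV f x) (inv_into UNIV f y)" for x y
    using f(2,3) by (metis bij_inv_eq_iff)
  ultimately show ?thesis
    using f(2) bij_imp_bij_inv unfolding isomorphic_algebras_def by blast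
qed

lemma isomorphic_algebras_trans:
  assumes "isomorphic_algebras smul \<phi> smul' \<psi>" "isomorphic_algebras smul' \<psi> smul'' \<theta>"
  shows "isomorphic_algebras smul \<phi> smul'' \<theta>"
proof -
  obtain f g where f: "Vector_Spaces.linear smul smul' f" "bij f" "\<And>x y. f (\<phi> x y) = \<psi> (f x) (f y)"
    and g: "Vector_Spaces.linear smul' smul'' g" "bij g" "\<And>x y. g (\<psi> x y) = \<theta> (g x) (g y)"
    using assms unfolding isomorphic_algebras_def by blast
  have "Vector_Spaces.linear smul smul'' (g \<circ> f)"
    using f(1) g(1) by (rule Vector_Spaces.linear_compose)
  moreover have "bij (g \<circ> f)"
    using f(2) g(2) by (rule bij_comp)
  ultimately show ?thesis
    using f(3) g(3) unfolding isomorphic_algebras_def by (auto intro!: exI[of _ "g \<circ> f"])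
qed

text \<open>
  The Jordan identity survives a change of basis, so it can be used again after each reduction step
  without tracking the equations between the structure constants.
\<close>

lemma jordan_algebra_isomorphic:
  assumes iso: "isomorphic_algebras smul \<phi> smul' \<psi>" and "jordan_algebra smul \<phi>"
  shows "jordan_algebra smul' \<psi>"
proof -
  interpret jordan_algebra smul \<phi> by fact
  obtain f where f: "Vector_Spaces.linear smul' smul f" "bij f" "\<And>x y. f (\<psi> x y) = \<phi> (f x) (f y)"
    using isomorphic_algebras_sym[OF iso] unfolding isomorphic_algebras_def by blast
  interpret f: Vector_Spaces.linear smul' smul f by (rule f(1))
  have eq: "x = y" if "f x = f y" for x y
    using that f(2) by (simp add: bij_is_inj inj_eq)
  show ?thesis
  proof unfold_locales
    show "\<psi> x (y + z) = \<psi> x y + \<psi> x z" for x y z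
      by (rule eq) (simp add: f(3) f.add product_simps)
    show "\<psi> x (smul' c y) = smul' c (\<psi> x y)" for c x y
      by (rule eq) (simp add: f(3) f.scale product_simps)
    show "\<psi> x y = \<psi> y x" for x y
      by (rule eq) (simp add: f(3) commute)
    show "\<psi> (\<psi> x x) (\<psi> x y) = \<psi> x (\<psi> (\<psi> x x) y)" for x y
      by (rule eq) (simp add: f(3) jordan)
  qed
qed

text \<open>
  Both laws are determined by the products of basis vectors, so it suffices that the rows of an
  invertible matrix multiply under \<open>\<psi>\<close> as the standard basis does under \<open>\<psi>'\<close>.
\<close>

lemma isomorphic_by_basis:
  fixes P :: "complex ^ 4 ^ 4"
  assumes bil: "comm_bilinear \<psi>" "comm_bilinear \<psi>'"
    and free: "\<And>x. x v* P = 0 \<Longrightarrow> x = 0"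
    and products: "\<And>i j. \<psi> (P $ i) (P $ j) = \<psi>' (e i) (e j) v* P"
  shows "isomorphic_algebras (*s) \<psi> (*s) \<psi>'"
proof -
  define F where "F x = x v* P" for x
  have F: "F x = (\<Sum>i\<in>UNIV. x $ i *s P $ i)" for x
    by (simp add: F_def vec4_eq_iff vector_matrix_mult_def sum_4 mult.commute)
  interpret F: Vector_Spaces.linear "(*s)" "(*s)" F
    by unfold_locales (simp_all add: F sum.distrib vector_sadd_rdistrib vec.scale_sum_right vector_smult_assoc)
  have "inj F"
    using free by (simp add: F_def F.inj_iff_eq_0)
  then have "bij F"
    using vec.linear_inj_imp_surj[OF F.linear_axioms] by (simp add: bij_def)
  have "\<psi> (P $ i) (P $ j) = F (\<psi>' (e i) (e j))" for i j
    using products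
    by (simp add: F_def)
  then have "F (\<psi>' x y) = \<psi> (F x) (F y)" for x y
    unfolding F[of x] F[of y] comm_bilinear_expand[OF bil(1)]
    by (subst (1) vec4_expansion[of x], subst (1) vec4_expansion[of y], subst comm_bilinear_expand[OF bil(2)])
      (simp add: F.sum F.scale)
  then have "isomorphic_algebras (*s) \<psi>' (*s) \<psi>"
    using \<open>bij F\<close> F.linear_axioms unfolding isomorphic_algebras_def by blast
  then show ?thesis
    by (rule isomorphic_algebras_sym)
qed

section \<open>Triangular structure constants\<close>

text \<open>
  With \<open>e\<^sub>1, \<dots>, e\<^sub>4\<close> as a flag basis, the ten parameters are the possibly nonzero structure constants:
  \<open>e\<^sub>1e\<^sub>1 = a\<^sub>2e\<^sub>2 + a\<^sub>3e\<^sub>3 + a\<^sub>4e\<^sub>4\<close>, \<open>e\<^sub>1e\<^sub>2 = c\<^sub>3e\<^sub>3 + c\<^sub>4e\<^sub>4\<close>, \<open>e\<^sub>2e\<^sub>2 = d\<^sub>3e\<^sub>3 + d\<^sub>4e\<^sub>4\<close>, \<open>e\<^sub>1e\<^sub>3 = fe\<^sub>4\<close>,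
  \<open>e\<^sub>2e\<^sub>3 = ge\<^sub>4\<close>, \<open>e\<^sub>3e\<^sub>3 = he\<^sub>4\<close>.
\<close>

definition triangular :: "complex \<Rightarrow> complex \<Rightarrow> complex \<Rightarrow> complex \<Rightarrow> complex \<Rightarrow> complex \<Rightarrow> complex \<Rightarrow>
    complex \<Rightarrow> complex \<Rightarrow> complex \<Rightarrow> law4" where
  "triangular a\<^sub>2 a\<^sub>3 a\<^sub>4 c\<^sub>3 c\<^sub>4 d\<^sub>3 d\<^sub>4 f g h = (\<lambda>x y. vector [0, a\<^sub>2 * (x $ 1 * y $ 1),
     a\<^sub>3 * (x $ 1 * y $ 1) + c\<^sub>3 * (x $ 1 * y $ 2 + x $ 2 * y $ 1) + d\<^sub>3 * (x $ 2 * y $ 2),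
     a\<^sub>4 * (x $ 1 * y $ 1) + c\<^sub>4 * (x $ 1 * y $ 2 + x $ 2 * y $ 1) + d\<^sub>4 * (x $ 2 * y $ 2)
       + f * (x $ 1 * y $ 3 + x $ 3 * y $ 1) + g * (x $ 2 * y $ 3 + x $ 3 * y $ 2) + h * (x $ 3 * y $ 3)])"

lemma comm_bilinear_triangular:
  "comm_bilinear (triangular a\<^sub>2 a\<^sub>3 a\<^sub>4 c\<^sub>3 c\<^sub>4 d\<^sub>3 d\<^sub>4 f g h)"
  unfolding comm_bilinear_def
  by (intro conjI allI; (unfold_locales)?)
    (simp_all add: triangular_def vec4_eq_iff algebra_simps)

lemma comm_bilinear_phi: "i \<in> {1..12} \<Longrightarrow> comm_bilinear (phi i)"
  by (intro jordan_algebra_comm_bilinear phi_jordan_algebra)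

text \<open>
  The descending central sequence starts outside \<open>W\<close> and ends inside. In its last term outside \<open>W\<close>
  pick \<open>b\<close>; the products with \<open>b\<close> lie in the next term, hence in \<open>W\<close>.
\<close>

lemma (in jordan_algebra) flag_step:
  assumes nil: "central_seq smul \<phi> k = {0}" and W: "subspace W" "W \<noteq> UNIV"
  shows "\<exists>b. b \<notin> W \<and> (\<forall>y. \<phi> b y \<in> W)"
proof -
  have "central_seq smul \<phi> k \<subseteq> W"
    using nil subspace_0[OF W(1)] by simp
  then obtain l where l: "central_seq smul \<phi> l \<subseteq> W" "\<And>m. m < l \<Longrightarrow> \<not> central_seq smul \<phi> m \<subseteq> W"
    using exists_least_iff[of "\<lambda>m. central_seq smul \<phi> m \<subseteq> W"] by blast
  moreover have "\<not> central_seq smul \<phi> 0 \<subseteq> W" "\<not> central_seq smul \<phi> (Suc 0) \<subseteq> W"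
    using W(2) by auto
  ultimately have "l \<noteq> 0" "l \<noteq> Suc 0"
    by metis+
  then obtain m where "l = Suc (Suc m)"
    by (metis not0_implies_Suc)
  then have m: "\<not> central_seq smul \<phi> (Suc m) \<subseteq> W" "central_seq smul \<phi> (Suc (Suc m)) \<subseteq> W"
    using l(1) l(2)[of "Suc m"] by auto
  then obtain b where b: "b \<in> central_seq smul \<phi> (Suc m)" "b \<notin> W"
    by auto
  then have "\<phi> b y \<in> central_seq smul \<phi> (Suc (Suc m))" for y
    by (auto intro!: span_base)
  then show ?thesis
    using m b by blast
qed

lemma triangularI:
  assumes bil: "comm_bilinear \<psi>"
    and 1: "\<And>j. \<psi> (e 1) (e j) $ 1 = 0"
    and 2: "\<And>j k. k \<in> {1, 2} \<Longrightarrow> \<psi> (e 2) (e j) $ k = 0"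
    and 3: "\<And>j k. k \<in> {1, 2, 3} \<Longrightarrow> \<psi> (e 3) (e j) $ k = 0"
    and 4: "\<And>j. \<psi> (e 4) (e j) = 0"
  shows "\<exists>a\<^sub>2 a\<^sub>3 a\<^sub>4 c\<^sub>3 c\<^sub>4 d\<^sub>3 d\<^sub>4 f g h. \<psi> = triangular a\<^sub>2 a\<^sub>3 a\<^sub>4 c\<^sub>3 c\<^sub>4 d\<^sub>3 d\<^sub>4 f g h"
proof -
  have comm: "\<psi> (e 1) (e 2) = \<psi> (e 2) (e 1)" "\<psi> (e 1) (e 3) = \<psi> (e 3) (e 1)" "\<psi> (e 1) (e 4) = \<psi> (e 4) (e 1)"
    "\<psi> (e 2) (e 3) = \<psi> (e 3) (e 2)" "\<psi> (e 2) (e 4) = \<psi> (e 4) (e 2)" "\<psi> (e 3) (e 4) = \<psi> (e 4) (e 3)"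
    using bil by (auto simp: comm_bilinear_def)
  have "\<psi> = triangular (\<psi> (e 1) (e 1) $ 2) (\<psi> (e 1) (e 1) $ 3) (\<psi> (e 1) (e 1) $ 4)
      (\<psi> (e 2) (e 1) $ 3) (\<psi> (e 2) (e 1) $ 4) (\<psi> (e 2) (e 2) $ 3) (\<psi> (e 2) (e 2) $ 4)
      (\<psi> (e 3) (e 1) $ 4) (\<psi> (e 3) (e 2) $ 4) (\<psi> (e 3) (e 3) $ 4)"
  proof (intro ext)
    fix x y
    have "\<psi> x y = (\<Sum>i\<in>UNIV. \<Sum>j\<in>UNIV. (x $ i * y $ j) *s \<psi> (e i) (e j))"
      by (subst (1) vec4_expansion[of x], subst (1) vec4_expansion[of y], rule comm_bilinear_expand[OF bil])
    then show "\<psi> x y = triangular (\<psi> (e 1) (e 1) $ 2) (\<psi> (e 1) (e 1) $ 3) (\<psi> (e 1) (e 1) $ 4)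
      (\<psi> (e 2) (e 1) $ 3) (\<psi> (e 2) (e 1) $ 4) (\<psi> (e 2) (e 2) $ 3) (\<psi> (e 2) (e 2) $ 4)
      (\<psi> (e 3) (e 1) $ 4) (\<psi> (e 3) (e 2) $ 4) (\<psi> (e 3) (e 3) $ 4) x y"
      by (simp add: triangular_def vec4_eq_iff sum_4 comm 1 2 3 4 algebra_simps)
  qed
  then show ?thesis
    by blast
qed


text \<open>
  Four flag steps, starting from the zero subspace and building the basis from its last vector to
  its first.
\<close>

lemma (in jordan_algebra) nilpotent_triangular_model:
  assumes dim: "dim UNIV = 4" and nil: "central_seq smul \<phi> k = {0}"
  shows "\<exists>a\<^sub>2 a\<^sub>3 a\<^sub>4 c\<^sub>3 c\<^sub>4 d\<^sub>3 d\<^sub>4 f g h.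
    isomorphic_algebras smul \<phi> (*s) (triangular a\<^sub>2 a\<^sub>3 a\<^sub>4 c\<^sub>3 c\<^sub>4 d\<^sub>3 d\<^sub>4 f g h)"
proof -
  have proper: "span S \<noteq> UNIV" if "finite S" "card S < 4" for S
    using dim_le_card[of UNIV S] that dim by auto
  have step: "\<exists>b. b \<notin> span S \<and> (\<forall>y. \<phi> b y \<in> span S)" if "finite S" "card S < 4" for S
    using flag_step[OF nil subspace_span proper[OF that]] .
  have card_le: "card {x, y, z} < 4" for x y z :: 'b
    using card_length[of "[x, y, z]"] by simp
  obtain b4 where b4: "b4 \<notin> span {}" "\<And>y. \<phi> b4 y \<in> span {}"
    using step[of "{}"] by auto
  obtain b3 where b3: "b3 \<notin> span {b4}" "\<And>y. \<phi> b3 y \<in> span {b4}"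
    using step[of "{b4}"] by auto
  obtain b2 where b2: "b2 \<notin> span {b3, b4}" "\<And>y. \<phi> b2 y \<in> span {b3, b4}"
    using step[of "{b3, b4}"] card_le[of b3 b3 b4] by auto
  obtain b1 where b1: "b1 \<notin> span {b2, b3, b4}" "\<And>y. \<phi> b1 y \<in> span {b2, b3, b4}"
    using step[of "{b2, b3, b4}"] card_le[of b2 b3 b4] by auto
  have indep: "independent {b1, b2, b3, b4}"
    by (intro independent_insertI b1(1) b2(1) b3(1) b4(1) independent_empty)
  have distinct: "b1 \<noteq> b2" "b1 \<noteq> b3" "b1 \<noteq> b4" "b2 \<noteq> b3" "b2 \<noteq> b4" "b3 \<noteq> b4"
    using b1(1) b2(1) b3(1) by (metis span_base insertCI)+
  have spanning: "span {b1, b2, b3, b4} = UNIV"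
  proof -
    obtain B where B: "independent B" "UNIV \<subseteq> span B" "card B = 4"
      using basis_exists[of UNIV] dim by metis
    interpret finite_dimensional_vector_space smul B
      using B by unfold_locales (auto simp: card_ge_0_finite)
    show ?thesis
      using card_ge_dim_independent[of "{b1, b2, b3, b4}" UNIV] indep dim distinct by auto
  qed
  define G where "G x = smul (x $ 1) b1 + smul (x $ 2) b2 + smul (x $ 3) b3 + smul (x $ 4) b4"
    for x :: "complex ^ 4"
  interpret G: Vector_Spaces.linear "(*s)" smul G
    by unfold_locales (simp_all add: G_def scale_left_distrib scale_right_distrib add_ac)
  have "inj G"
  proof (subst G.inj_iff_eq_0, intro allI impI)
    fix x
    assume x: "G x = 0"
    define u where "u v = (if v = b1 then x $ 1 else if v = b2 then x $ 2
        else if v = b3 then x $ 3 else x $ 4)" for v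
    have "(\<Sum>v\<in>{b1, b2, b3, b4}. smul (u v) v) = G x"
      using distinct by (simp add: u_def G_def add_ac)
    then have "\<forall>v\<in>{b1, b2, b3, b4}. u v = 0"
      using independentD[OF indep _ order_refl] x by auto
    then show "x = 0"
      using distinct by (simp add: u_def vec4_eq_iff)
  qed
  have G_e: "G (e 1) = b1" "G (e 2) = b2" "G (e 3) = b3" "G (e 4) = b4"
    by (simp_all add: G_def)
  have G_vec: "G (vector [p, q, r, s]) = smul p b1 + smul q b2 + smul r b3 + smul s b4" for p q r s
    by (simp add: G_def)
  have "surj G"
  proof (rule surjI)
    fix v
    have "v \<in> span {b1, b2, b3, b4}"
      using spanning by simp
    then obtain p q r s where "v - smul p b1 - smul q b2 - smul r b3 - smul s b4 = 0"
      by (auto simp: span_breakdown_eq)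
    then have "G (vector [p, q, r, s]) = v"
      by (simp add: G_vec algebra_simps)
    then show "G (inv_into UNIV G v) = v"
      by (metis f_inv_into_f rangeI)
  qed
  with \<open>inj G\<close> have "bij G"
    by (simp add: bij_def)
  define \<psi> where "\<psi> x y = inv_into UNIV G (\<phi> (G x) (G y))" for x y
  have G_\<psi>: "G (\<psi> x y) = \<phi> (G x) (G y)" for x y
    using \<open>bij G\<close> by (simp add: \<psi>_def bij_is_surj surj_f_inv_f)
  have iso: "isomorphic_algebras smul \<phi> (*s) \<psi>"
    by (rule isomorphic_algebras_sym)
      (use G.linear_axioms \<open>bij G\<close> G_\<psi> in \<open>auto simp: isomorphic_algebras_def\<close>)
  have \<psi>_eq: "\<psi> x y = z" if "\<phi> (G x) (G y) = G z" for x y z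
    using that \<open>inj G\<close> by (metis G_\<psi> injD)
  have "\<exists>a\<^sub>2 a\<^sub>3 a\<^sub>4 c\<^sub>3 c\<^sub>4 d\<^sub>3 d\<^sub>4 f g h. \<psi> = triangular a\<^sub>2 a\<^sub>3 a\<^sub>4 c\<^sub>3 c\<^sub>4 d\<^sub>3 d\<^sub>4 f g h"
  proof (rule triangularI)
    show "comm_bilinear \<psi>"
      using jordan_algebra_isomorphic[OF iso jordan_algebra_axioms] by (rule jordan_algebra_comm_bilinear)
    show "\<psi> (e 1) (e j) $ 1 = 0" for j
    proof -
      obtain q r s where "\<phi> b1 (G (e j)) - smul q b2 - smul r b3 - smul s b4 = 0"
        using b1(2)[of "G (e j)"] by (auto simp: span_breakdown_eq)
      then have "\<psi> (e 1) (e j) = vector [0, q, r, s]"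
        by (intro \<psi>_eq) (simp add: G_e G_vec algebra_simps)
      then show ?thesis by simp
    qed
    show "\<psi> (e 2) (e j) $ k = 0" if "k \<in> {1, 2}" for j k
    proof -
      obtain r s where "\<phi> b2 (G (e j)) - smul r b3 - smul s b4 = 0"
        using b2(2)[of "G (e j)"] by (auto simp: span_breakdown_eq)
      then have "\<psi> (e 2) (e j) = vector [0, 0, r, s]"
        by (intro \<psi>_eq) (simp add: G_e G_vec algebra_simps)
      then show ?thesis using that by auto
    qed
    show "\<psi> (e 3) (e j) $ k = 0" if "k \<in> {1, 2, 3}" for j k
    proof -
      obtain s where "\<phi> b3 (G (e j)) - smul s b4 = 0"
        using b3(2)[of "G (e j)"] by (auto simp: span_breakdown_eq)
      then have "\<psi> (e 3) (e j) = vector [0, 0, 0, s]"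
        by (intro \<psi>_eq) (simp add: G_e G_vec algebra_simps)
      then show ?thesis using that by auto
    qed
    show "\<psi> (e 4) (e j) = 0" for j
      using b4(2)[of "G (e j)"] by (intro \<psi>_eq) (simp add: G_e)
  qed
  then show ?thesis
    using iso by metis
qed

section \<open>Changes of basis and squares outside the last two layers\<close>

definition classified :: "law4 \<Rightarrow> bool" where
  "classified \<psi> \<longleftrightarrow> (\<exists>i\<in>{1..12}. isomorphic_algebras (*s) \<psi> (*s) (phi i))"

lemma classified_isomorphic:
  assumes "isomorphic_algebras (*s) \<psi> (*s) \<psi>'" "classified \<psi>'"
  shows "classified \<psi>"
  using assms isomorphic_algebras_trans unfolding classified_def by blast

text \<open>
  The vectors \<open>p, q, r, s\<close> form a basis in which \<open>\<psi>\<close> has the multiplication table of \<open>\<psi>'\<close>. Only the ten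
  products with ordered indices are listed, as both laws will be commutative; with explicit vectors
  the simplifier then reduces the whole condition to polynomial identities in the parameters.
\<close>

definition change_of_basis ::
  "complex ^ 4 \<Rightarrow> complex ^ 4 \<Rightarrow> complex ^ 4 \<Rightarrow> complex ^ 4 \<Rightarrow> law4 \<Rightarrow> law4 \<Rightarrow> bool" where
  "change_of_basis p q r s \<psi> \<psi>' \<longleftrightarrow>
     (\<forall>\<alpha> \<beta> \<gamma> \<delta>. \<alpha> *s p + \<beta> *s q + \<gamma> *s r + \<delta> *s s = 0 \<longrightarrow> \<alpha> = 0 \<and> \<beta> = 0 \<and> \<gamma> = 0 \<and> \<delta> = 0) \<and>
     (\<forall>(x, y, v) \<in> {(p, p, \<psi>' (e 1) (e 1)), (p, q, \<psi>' (e 1) (e 2)), (p, r, \<psi>' (e 1) (e 3)),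
        (p, s, \<psi>' (e 1) (e 4)), (q, q, \<psi>' (e 2) (e 2)), (q, r, \<psi>' (e 2) (e 3)),
        (q, s, \<psi>' (e 2) (e 4)), (r, r, \<psi>' (e 3) (e 3)), (r, s, \<psi>' (e 3) (e 4)),
        (s, s, \<psi>' (e 4) (e 4))}. \<psi> x y = v $ 1 *s p + v $ 2 *s q + v $ 3 *s r + v $ 4 *s s)"

lemma change_of_basis_isomorphic:
  assumes bil: "comm_bilinear \<psi>" "comm_bilinear \<psi>'" and cob: "change_of_basis p q r s \<psi> \<psi>'"
  shows "isomorphic_algebras (*s) \<psi> (*s) \<psi>'"
proof (rule isomorphic_by_basis[OF bil])
  have mult: "x v* vector [p, q, r, s] = x $ 1 *s p + x $ 2 *s q + x $ 3 *s r + x $ 4 *s s" for x :: "complex ^ 4"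
    by (simp add: vec4_eq_iff vector_matrix_mult_def sum_4 mult.commute)
  show "x = 0" if "x v* vector [p, q, r, s] = 0" for x :: "complex ^ 4"
    using that conjunct1[OF cob[unfolded change_of_basis_def], rule_format, of "x $ 1" "x $ 2" "x $ 3" "x $ 4"]
    unfolding mult by (simp add: vec4_eq_iff[of x])
  have comm: "\<psi> x y = \<psi> y x" "\<psi>' x y = \<psi>' y x" for x y
    using bil by (simp_all add: comm_bilinear_def)
  have "\<forall>i j. \<psi> (vector [p, q, r, s] $ i) (vector [p, q, r, s] $ j) = \<psi>' (e i) (e j) v* vector [p, q, r, s]"
    using conjunct2[OF cob[unfolded change_of_basis_def]] unfolding forall_4 mult
    by (simp add: comm[of q p] comm[of r p] comm[of s p] comm[of r q] comm[of s q] comm[of s r]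
        comm[of "e 2" "e 1"] comm[of "e 3" "e 1"] comm[of "e 4" "e 1"] comm[of "e 3" "e 2"]
        comm[of "e 4" "e 2"] comm[of "e 4" "e 3"])
  then show "\<psi> (vector [p, q, r, s] $ i) (vector [p, q, r, s] $ j) = \<psi>' (e i) (e j) v* vector [p, q, r, s]" for i j
    by blast
qed

lemmas triangular_isomorphic =
  change_of_basis_isomorphic[OF comm_bilinear_triangular comm_bilinear_triangular]

lemma triangular_classified:
  assumes "change_of_basis p q r s (triangular a\<^sub>2 a\<^sub>3 a\<^sub>4 c\<^sub>3 c\<^sub>4 d\<^sub>3 d\<^sub>4 f g h) (phi i)" "i \<in> {1..12}"
  shows "classified (triangular a\<^sub>2 a\<^sub>3 a\<^sub>4 c\<^sub>3 c\<^sub>4 d\<^sub>3 d\<^sub>4 f g h)"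
  using change_of_basis_isomorphic[OF comm_bilinear_triangular comm_bilinear_phi assms(1)] assms(2)
  unfolding classified_def by blast

lemmas basis_simps = change_of_basis_def triangular_def phi_components vec4_eq_iff

text \<open>
  Instead of dividing, the reductions below replace one parameter by a multiple of another, so that
  the conditions on a new basis stay polynomial.
\<close>

lemma exists_factor: "a \<noteq> 0 \<Longrightarrow> \<exists>k. b = a * (k :: complex)"
  by (rule exI[of _ "b / a"]) simp

lemma exists_square_factor: "a \<noteq> 0 \<Longrightarrow> \<exists>k. b = a * (k * k :: complex)"
  by (rule exI[of _ "csqrt (b / a)"]) (simp flip: power2_eq_square)

text \<open>
  All products but \<open>e\<^sub>1e\<^sub>1 = e\<^sub>2\<close> lie on the line of \<open>e\<^sub>4\<close>. The algebra is governed by the linear form \<open>(c, g)\<close>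
  that describes multiplication by \<open>e\<^sub>2\<close> on the span of \<open>e\<^sub>1\<close> and \<open>e\<^sub>3\<close>, where the square is \<open>x\<^sub>1\<^sup>2e\<^sub>2\<close> modulo
  \<open>e\<^sub>4\<close>: it is not proportional to \<open>x\<^sub>1\<close> (case 1), a nonzero multiple of it (cases 2 and 3), or zero.
  Adding multiples of \<open>e\<^sub>2\<close> to \<open>e\<^sub>1\<close> and \<open>e\<^sub>3\<close> changes the remaining form \<open>2fx\<^sub>1x\<^sub>3 + hx\<^sub>3\<^sup>2\<close> by multiples of
  \<open>(c, g)\<close>.
\<close>

lemma classified_family: "classified (triangular 1 0 0 0 c 0 0 f g h)"
proof -
  consider "g \<noteq> 0" | "g = 0" "c \<noteq> 0" "h \<noteq> 0" | "g = 0" "c \<noteq> 0" "h = 0" | "g = 0" "c = 0" "h \<noteq> 0"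
    | "g = 0" "c = 0" "h = 0" "f \<noteq> 0" | "g = 0" "c = 0" "h = 0" "f = 0"
    by blast
  then show ?thesis
  proof cases
    case 1
    \<comment> \<open>\<open>u\<close> makes \<open>E = e\<^sub>3 - u e\<^sub>2\<close> a vector of square zero, \<open>s\<close> makes multiplication by the square take the
      same value at \<open>e\<^sub>1 - s E\<close> and \<open>E\<close>, and \<open>v\<close> removes the mixed product.\<close>
    obtain s where "c - g = g * s"
      using exists_factor[OF 1] by blast
    then have c: "c = g + g * s"
      by (simp add: algebra_simps)
    have "2 * g \<noteq> 0"
      using 1 by simp
    then obtain u where h: "h = 2 * g * u"
      using exists_factor by blast
    obtain v where "f - u * c = g * v"
      using exists_factor[OF 1] by blast
    then have f: "f = u * (g + g * s) + g * v"
      by (simp add: c algebra_simps)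
    have "change_of_basis (vector [1, s * u - v, - s, 0]) (vector [0, 1, 0, - 2 * v * c])
        (vector [0, 0, 0, g]) (vector [0, - u, 1, 0]) (triangular 1 0 0 0 c 0 0 f g h) (phi 5)"
      using 1 by (auto simp: basis_simps c h f algebra_simps)
    then show ?thesis
      by (rule triangular_classified) simp
  next
    case 2
    obtain u where f: "f = c * u"
      using exists_factor[OF 2(2)] by blast
    obtain k where c: "c = h * (k * k)"
      using exists_square_factor[OF 2(3)] by blast
    have "change_of_basis (vector [1, 0, 0, 0]) (vector [0, 1, 0, 0]) (vector [0, 0, 0, c])
        (vector [0, - k * u, k, 0]) (triangular 1 0 0 0 c 0 0 f g h) (phi 6)"
      using 2 by (auto simp: basis_simps f c algebra_simps)
    then show ?thesis
      by (rule triangular_classified) simp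
  next
    case 3
    obtain u where f: "f = c * u"
      using exists_factor[OF 3(2)] by blast
    have "change_of_basis (vector [1, 0, 0, 0]) (vector [0, 1, 0, 0]) (vector [0, 0, 0, c])
        (vector [0, - u, 1, 0]) (triangular 1 0 0 0 c 0 0 f g h) (phi 7)"
      using 3 by (auto simp: basis_simps f algebra_simps)
    then show ?thesis
      by (rule triangular_classified) simp
  next
    case 4
    obtain s where f: "f = h * s"
      using exists_factor[OF 4(3)] by blast
    have "change_of_basis (vector [1, 0, - s, 0]) (vector [0, 1, 0, - s * f]) (vector [0, 0, 1, 0])
        (vector [0, 0, 0, h]) (triangular 1 0 0 0 c 0 0 f g h) (phi 8)"
      using 4 by (auto simp: basis_simps f algebra_simps)
    then show ?thesis
      by (rule triangular_classified) simp
  next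
    case 5
    then have "change_of_basis (vector [1, 0, 0, 0]) (vector [0, 1, 0, 0]) (vector [0, 0, 1, 0])
        (vector [0, 0, 0, f]) (triangular 1 0 0 0 c 0 0 f g h) (phi 9)"
      by (auto simp: basis_simps)
    then show ?thesis
      by (rule triangular_classified) simp
  next
    case 6
    then have "change_of_basis (vector [1, 0, 0, 0]) (vector [0, 1, 0, 0]) (vector [0, 0, 1, 0])
        (vector [0, 0, 0, 1]) (triangular 1 0 0 0 c 0 0 f g h) (phi 12)"
      by (auto simp: basis_simps)
    then show ?thesis
      by (rule triangular_classified) simp
  qed
qed

text \<open>
  Here \<open>e\<^sub>2 = e\<^sub>1e\<^sub>1\<close>. The Jordan identity with \<open>x = y = e\<^sub>1\<close> says \<open>e\<^sub>2e\<^sub>2 = e\<^sub>1(e\<^sub>1e\<^sub>2)\<close>. If \<open>e\<^sub>1, e\<^sub>2, e\<^sub>1e\<^sub>2\<close> are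
  independent, two further instances make all products vanish except those among powers of \<open>e\<^sub>1\<close>, and
  only whether the fourth power of \<open>e\<^sub>1\<close> is zero remains open.
\<close>

lemma classified_square_second:
  assumes jordan: "jordan_algebra (*s) (triangular 1 0 0 c\<^sub>3 c\<^sub>4 d\<^sub>3 d\<^sub>4 f g h)"
  shows "classified (triangular 1 0 0 c\<^sub>3 c\<^sub>4 d\<^sub>3 d\<^sub>4 f g h)"
proof -
  let ?T = "triangular 1 0 0 c\<^sub>3 c\<^sub>4 d\<^sub>3 d\<^sub>4 f g h"
  note J = jordan_algebra.jordan[OF jordan]
  have d: "d\<^sub>3 = 0" "d\<^sub>4 = c\<^sub>3 * f"
    using J[of "e 1" "e 1"] by (simp_all add: triangular_def vec4_eq_iff mult.commute)
  show ?thesis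
  proof (cases "c\<^sub>3 = 0")
    case True
    then show ?thesis
      using classified_family d by simp
  next
    case False
    have g: "g = 0"
      using J[of "e 1" "e 2"] False d by (simp add: triangular_def vec4_eq_iff)
    have h: "h = 0"
      using J[of "e 1 + e 2" "e 2"] False d g by (simp add: triangular_def vec4_eq_iff)
    show ?thesis
    proof (cases "f = 0")
      case True
      have "change_of_basis (vector [1, 0, 0, 0]) (vector [0, 1, 0, 0]) (vector [0, 0, c\<^sub>3, c\<^sub>4])
        (vector [0, 0, 0, 1]) ?T (phi 7)"
        using True False d g h by (auto simp: basis_simps)
      then show ?thesis
        by (rule triangular_classified) simp
    next
      case f: False
      have "change_of_basis (vector [1, 0, 0, 0]) (vector [0, 1, 0, 0]) (vector [0, 0, c\<^sub>3, c\<^sub>4])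
        (vector [0, 0, 0, c\<^sub>3 * f]) ?T (phi 1)"
        using f False d g h by (auto simp: basis_simps)
      then show ?thesis
        by (rule triangular_classified) simp
    qed
  qed
qed

section \<open>Symmetric bilinear forms with values on a line\<close>

text \<open>
  On the span of \<open>e\<^sub>2\<close> and \<open>e\<^sub>3\<close> the form has the isotropic vector \<open>e\<^sub>2\<close> and is nondegenerate, so it has a
  second isotropic vector, as in \<open>\<phi>\<^sub>1\<^sub>0\<close>.
\<close>

lemma classified_hyperbolic_form:
  assumes A: "A \<noteq> 0" and g: "g \<noteq> 0"
  shows "classified (triangular 0 0 A 0 0 0 0 0 g h)"
proof -
  have "2 * g \<noteq> 0"
    using g by simp
  then obtain t where h: "h = 2 * g * t"
    using exists_factor by blast
  obtain k where k: "A = g * k"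
    using exists_factor[OF g] by blast
  have "change_of_basis (vector [1, 0, 0, 0]) (vector [0, 0, 0, A]) (vector [0, 1, 0, 0])
      (vector [0, - k * t, k, 0]) (triangular 0 0 A 0 0 0 0 0 g h) (phi 10)"
    using A by (auto simp: basis_simps k h)
  then show ?thesis
    by (rule triangular_classified) simp
qed

text \<open>
  A diagonal form of full rank is brought to the hyperbolic shape by an isotropic combination
  \<open>ke\<^sub>2 + e\<^sub>3\<close>.
\<close>

lemma classified_diagonal_form:
  assumes A: "A \<noteq> 0"
  shows "classified (triangular 0 0 A 0 0 0 D 0 0 h)"
proof -
  consider "D = 0" "h = 0" | "D \<noteq> 0" "h = 0" | "D = 0" "h \<noteq> 0" | "D \<noteq> 0" "h \<noteq> 0"
    by blast
  then show ?thesis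
  proof cases
    case 1
    then have "change_of_basis (vector [1, 0, 0, 0]) (vector [0, 0, 0, A]) (vector [0, 1, 0, 0])
        (vector [0, 0, 1, 0]) (triangular 0 0 A 0 0 0 D 0 0 h) (phi 12)"
      using A by (auto simp: basis_simps)
    then show ?thesis
      by (rule triangular_classified) simp
  next
    case 2
    obtain k where k: "A = D * (k * k)"
      using exists_square_factor[OF 2(1)] by blast
    have "change_of_basis (vector [1, 0, 0, 0]) (vector [0, 0, 0, A]) (vector [0, k, 0, 0])
        (vector [0, 0, 1, 0]) (triangular 0 0 A 0 0 0 D 0 0 h) (phi 11)"
      using A 2 by (auto simp: basis_simps k)
    then show ?thesis
      by (rule triangular_classified) simp
  next
    case 3
    obtain k where k: "A = h * (k * k)"
      using exists_square_factor[OF 3(2)] by blast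
    have "change_of_basis (vector [1, 0, 0, 0]) (vector [0, 0, 0, A]) (vector [0, 0, k, 0])
        (vector [0, 1, 0, 0]) (triangular 0 0 A 0 0 0 D 0 0 h) (phi 11)"
      using A 3 by (auto simp: basis_simps k)
    then show ?thesis
      by (rule triangular_classified) simp
  next
    case 4
    then have "- D \<noteq> 0"
      by simp
    then obtain k where k: "h = - D * (k * k)"
      using exists_square_factor by blast
    then have "k * D \<noteq> 0"
      using 4 by auto
    have "change_of_basis (vector [1, 0, 0, 0]) (vector [0, k, 1, 0]) (vector [0, 1, 0, 0])
        (vector [0, 0, 0, 1]) (triangular 0 0 A 0 0 0 D 0 0 h) (triangular 0 0 A 0 0 0 0 0 (k * D) D)"
      by (auto simp: basis_simps k)
    then show ?thesis
      by (rule classified_isomorphic[OF triangular_isomorphic classified_hyperbolic_form[OF A \<open>k * D \<noteq> 0\<close>]])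
  qed
qed

lemma classified_form_orthogonal:
  assumes A: "A \<noteq> 0"
  shows "classified (triangular 0 0 A 0 0 0 D 0 g h)"
proof -
  consider "D \<noteq> 0" | "D = 0" "g \<noteq> 0" | "D = 0" "g = 0"
    by blast
  then show ?thesis
  proof cases
    case 1
    obtain k where g: "g = D * k"
      using exists_factor[OF 1] by blast
    have "change_of_basis (vector [1, 0, 0, 0]) (vector [0, 1, 0, 0]) (vector [0, - k, 1, 0])
        (vector [0, 0, 0, 1]) (triangular 0 0 A 0 0 0 D 0 g h) (triangular 0 0 A 0 0 0 D 0 0 (h - k * g))"
      by (auto simp: basis_simps g algebra_simps)
    then show ?thesis
      by (rule classified_isomorphic[OF triangular_isomorphic classified_diagonal_form[OF A]])
  next
    case 2
    then show ?thesis
      using classified_hyperbolic_form[OF A] by simp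
  next
    case 3
    then show ?thesis
      using classified_diagonal_form[OF A] by simp
  qed
qed

text \<open>
  Since \<open>e\<^sub>1\<close> is anisotropic, its orthogonal complement can be split off.
\<close>

lemma classified_form_anisotropic:
  assumes A: "A \<noteq> 0"
  shows "classified (triangular 0 0 A 0 C 0 D f g h)"
proof -
  obtain p where C: "C = A * p"
    using exists_factor[OF A] by blast
  obtain q where f: "f = A * q"
    using exists_factor[OF A] by blast
  have "change_of_basis (vector [1, 0, 0, 0]) (vector [- p, 1, 0, 0]) (vector [- q, 0, 1, 0])
      (vector [0, 0, 0, 1]) (triangular 0 0 A 0 C 0 D f g h)
      (triangular 0 0 A 0 0 0 (D - p * C) 0 (g - p * f) (h - q * f))"
    by (auto simp: basis_simps C f algebra_simps)
  then show ?thesis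
    by (rule classified_isomorphic[OF triangular_isomorphic classified_form_orthogonal[OF A]])
qed

text \<open>
  A nonzero symmetric form has an anisotropic vector: one of the basis vectors or a sum of two of
  them.
\<close>

lemma classified_form:
  assumes "(A, C, D, f, g, h) \<noteq> (0, 0, 0, 0, 0, 0)"
  shows "classified (triangular 0 0 A 0 C 0 D f g h)"
proof -
  let ?T = "triangular 0 0 A 0 C 0 D f g h"
  have *: "classified ?T" if "change_of_basis p q r s ?T (triangular 0 0 A' 0 C' 0 D' f' g' h')" "A' \<noteq> 0"
    for p q r s A' C' D' f' g' h'
    by (rule classified_isomorphic[OF triangular_isomorphic[OF that(1)] classified_form_anisotropic[OF that(2)]])
  consider "A \<noteq> 0" | "D \<noteq> 0" | "h \<noteq> 0" | "A = 0" "D = 0" "h = 0" "C \<noteq> 0"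
    | "A = 0" "D = 0" "h = 0" "f \<noteq> 0" | "A = 0" "D = 0" "h = 0" "g \<noteq> 0"
    using assms by auto
  then show ?thesis
  proof cases
    case 1
    then show ?thesis
      by (rule classified_form_anisotropic)
  next
    case 2
    have "change_of_basis (vector [0, 1, 0, 0]) (vector [1, 0, 0, 0]) (vector [0, 0, 1, 0])
      (vector [0, 0, 0, 1]) ?T (triangular 0 0 D 0 C 0 A g f h)"
      by (auto simp: basis_simps)
    then show ?thesis
      using 2 by (rule *)
  next
    case 3
    have "change_of_basis (vector [0, 0, 1, 0]) (vector [0, 1, 0, 0]) (vector [1, 0, 0, 0])
      (vector [0, 0, 0, 1]) ?T (triangular 0 0 h 0 g 0 D f C A)"
      by (auto simp: basis_simps)
    then show ?thesis
      using 3 by (rule *)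
  next
    case 4
    have "change_of_basis (vector [1, 1, 0, 0]) (vector [0, 1, 0, 0]) (vector [0, 0, 1, 0])
      (vector [0, 0, 0, 1]) ?T (triangular 0 0 (2 * C) 0 C 0 0 (f + g) g 0)"
      using 4 by (auto simp: basis_simps)
    then show ?thesis
      by (rule *) (use 4 in simp)
  next
    case 5
    have "change_of_basis (vector [1, 0, 1, 0]) (vector [0, 1, 0, 0]) (vector [0, 0, 1, 0])
      (vector [0, 0, 0, 1]) ?T (triangular 0 0 (2 * f) 0 (C + g) 0 0 f g 0)"
      using 5 by (auto simp: basis_simps)
    then show ?thesis
      by (rule *) (use 5 in simp)
  next
    case 6
    have "change_of_basis (vector [0, 1, 1, 0]) (vector [1, 0, 0, 0]) (vector [0, 0, 1, 0])
      (vector [0, 0, 0, 1]) ?T (triangular 0 0 (2 * g) 0 (C + f) 0 0 g f 0)"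
      using 6 by (auto simp: basis_simps)
    then show ?thesis
      by (rule *) (use 6 in simp)
  qed
qed

section \<open>Binary quadratic forms modulo the last layer\<close>

text \<open>
  Here \<open>e\<^sub>3\<close> and \<open>e\<^sub>4\<close> are central, and the products of \<open>e\<^sub>1\<close> and \<open>e\<^sub>2\<close> are \<open>q e\<^sub>3 + r e\<^sub>4\<close> for the
  quadratic forms \<open>q = x\<^sup>2 + y\<^sup>2\<close> and \<open>r = 2cxy + dy\<^sup>2\<close>. The assumption says that the member \<open>q - tr\<close> of
  their pencil is singular. Replacing \<open>e\<^sub>4\<close> by \<open>e\<^sub>4 + te\<^sub>3\<close> makes it the coefficient of \<open>e\<^sub>3\<close>.
\<close>

lemma classified_central_pencil:
  assumes d: "t * d + t * t * (c * c) = 1"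
  shows "classified (triangular 0 1 0 0 c 1 d 0 0 0)"
proof -
  have "change_of_basis (vector [1, 0, 0, 0]) (vector [0, 0, 1, 0]) (vector [t * c, 1, 0, 0])
      (vector [0, 0, t, 1]) (triangular 0 1 0 0 c 1 d 0 0 0)
      (triangular 1 0 0 0 0 0 0 c 0 (d + 2 * t * (c * c)))"
    using d by (auto simp: basis_simps algebra_simps)
  then show ?thesis
    by (rule classified_isomorphic[OF triangular_isomorphic classified_family])
qed

text \<open>
  Choose \<open>fe\<^sub>1 + ge\<^sub>2\<close> and the vector \<open>- ge\<^sub>1 + fe\<^sub>2\<close> orthogonal to it, which is annihilated by \<open>e\<^sub>3\<close>. Both
  squares are \<open>Ne\<^sub>3\<close> modulo \<open>e\<^sub>4\<close>; multiples of \<open>e\<^sub>3\<close> added to the two vectors make the squares equal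
  and the mixed product zero, as in \<open>\<phi>\<^sub>2\<close>.
\<close>

lemma classified_nonisotropic:
  assumes N: "f * f + g * g \<noteq> 0"
  shows "classified (triangular 0 1 0 0 c 1 d f g 0)"
proof -
  define N where "N = f * f + g * g"
  have "N \<noteq> 0"
    using N by (simp add: N_def)
  then have N0: "N \<noteq> 0" "2 * N \<noteq> 0"
    by simp_all
  \<comment> \<open>\<open>a\<close> and \<open>b\<close> are the multiples of \<open>e\<^sub>3\<close> that equalize the squares and cancel the mixed product;
    \<open>?\<rho>\<close> is the \<open>e\<^sub>4\<close>-coordinate of the common square.\<close>
  obtain a where a: "- 2 * (2 * f * g * c) + (f * f - g * g) * d = 2 * N * a"
    using exists_factor[OF N0(2)] by blast
  obtain b where b: "(f * f - g * g) * c + f * g * d = N * b"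
    using exists_factor[OF N0(1)] by blast
  let ?\<rho> = "f * f * d - 2 * f * g * c"
  have free: "\<alpha> = 0 \<and> \<delta> = 0" if "\<alpha> * f = \<delta> * g" "\<alpha> * g + \<delta> * f = 0" for \<alpha> \<delta>
  proof -
    have "\<alpha> * N = f * (\<alpha> * f) + g * (\<alpha> * g)" "\<delta> * N = f * (\<delta> * f) + g * (\<delta> * g)"
      by (simp_all add: N_def algebra_simps)
    moreover have "\<alpha> * g = - (\<delta> * f)"
      using that(2) by (simp add: eq_neg_iff_add_eq_0)
    ultimately have "\<alpha> * N = 0" "\<delta> * N = 0"
      using that(1) by (auto simp: algebra_simps)
    then show ?thesis
      using N0 by simp
  qed
  have "change_of_basis (vector [f, g, a, 0]) (vector [0, 0, N, ?\<rho>]) (vector [0, 0, 0, N * N])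
      (vector [- g, f, - b, 0]) (triangular 0 1 0 0 c 1 d f g 0) (phi 2)"
    unfolding change_of_basis_def
  proof (rule conjI, intro allI impI)
    fix \<alpha> \<beta> \<gamma> \<delta>
    assume 0: "\<alpha> *s vector [f, g, a, 0] + \<beta> *s vector [0, 0, N, ?\<rho>] + \<gamma> *s vector [0, 0, 0, N * N]
      + \<delta> *s vector [- g, f, - b, 0] = (0 :: complex ^ 4)"
    then have "\<alpha> = 0 \<and> \<delta> = 0"
      by (intro free) (simp_all add: vec4_eq_iff)
    with 0 N0 show "\<alpha> = 0 \<and> \<beta> = 0 \<and> \<gamma> = 0 \<and> \<delta> = 0"
      by (auto simp: vec4_eq_iff)
  qed (use a b in \<open>auto simp: basis_simps algebra_simps N_def\<close>)
  then show ?thesis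
    by (rule triangular_classified) simp
qed

text \<open>
  After scaling \<open>e\<^sub>2\<close> by a square root of \<open>-1\<close>, the square becomes \<open>(x\<^sup>2 - y\<^sup>2)e\<^sub>3\<close> modulo \<open>e\<^sub>4\<close> and
  multiplication by \<open>e\<^sub>3\<close> becomes \<open>f(x + y)\<close>, which divides \<open>x\<^sup>2 - y\<^sup>2\<close>. Because of this common factor one
  coefficient, \<open>\<kappa>\<close>, cannot be removed by adding multiples of \<open>e\<^sub>3\<close>: it is zero for \<open>\<phi>\<^sub>4\<close>, and scaling
  makes it \<open>-1\<close> for \<open>\<phi>\<^sub>3\<close>.
\<close>

lemma classified_isotropic:
  assumes f: "f \<noteq> 0" and \<epsilon>: "\<epsilon> * \<epsilon> = -1"
  shows "classified (triangular 0 1 0 0 c 1 d f (\<epsilon> * f) 0)"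
proof -
  define \<kappa> where "\<kappa> = 2 * \<epsilon> * c - d"
  have \<epsilon>0: "\<epsilon> \<noteq> 0"
    using \<epsilon> by auto
  have \<epsilon>': "\<epsilon> * (\<epsilon> * x) = - x" for x
    using \<epsilon> by (metis mult.assoc mult_minus1)
  obtain b where c: "c = f * b"
    using exists_factor[OF f] by blast
  have d: "d = 2 * \<epsilon> * c - \<kappa>"
    by (simp add: \<kappa>_def)
  show ?thesis
  proof (cases "\<kappa> = 0")
    case True
    have "change_of_basis (vector [1, 0, 0, 0]) (vector [0, 0, 1, 0]) (vector [0, 0, 0, f])
        (vector [0, - \<epsilon>, \<epsilon> * b, 0]) (triangular 0 1 0 0 c 1 d f (\<epsilon> * f) 0) (phi 4)"
      using f \<epsilon>0 by (auto simp: basis_simps d c True \<epsilon> \<epsilon>' algebra_simps)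
    then show ?thesis
      by (rule triangular_classified) simp
  next
    case False
    obtain s where s: "\<kappa> = f * s"
      using exists_factor[OF f] by blast
    have "change_of_basis (vector [- s, 0, 0, 0]) (vector [0, 0, s * s, 0]) (vector [0, 0, 0, - s * s * s * f])
        (vector [0, s * \<epsilon>, - s * \<epsilon> * b, 0]) (triangular 0 1 0 0 c 1 d f (\<epsilon> * f) 0) (phi 3)"
      using f \<epsilon>0 False by (auto simp: basis_simps d c s \<epsilon> \<epsilon>' algebra_simps)
    then show ?thesis
      by (rule triangular_classified) simp
  qed
qed

text \<open>
  If \<open>(f, g)\<close> vanishes, a singular member of the pencil of \<open>classified_central_pencil\<close> is found by
  solving a quadratic equation, unless the pencil is spanned by \<open>x\<^sup>2 + y\<^sup>2\<close> alone.
\<close>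

lemma classified_two_squares: "classified (triangular 0 1 0 0 c 1 d f g 0)"
proof -
  consider "f * f + g * g \<noteq> 0" | "f * f + g * g = 0" "f \<noteq> 0" | "f = 0" "g = 0"
    by (cases "f = 0") auto
  then show ?thesis
  proof cases
    case 1
    then show ?thesis by (rule classified_nonisotropic)
  next
    case 2
    obtain \<epsilon> where g: "g = f * \<epsilon>"
      using exists_factor[OF 2(2)] by blast
    have "f * f * (1 + \<epsilon> * \<epsilon>) = 0"
      using 2(1) by (simp add: g algebra_simps)
    then have "\<epsilon> * \<epsilon> = -1"
      using 2(2) by (simp add: add_eq_0_iff)
    then show ?thesis
      using classified_isotropic[OF 2(2)] by (simp add: g mult.commute)
  next
    case 3
    show ?thesis
    proof (cases "c = 0")
      case True
      show ?thesis
      proof (cases "d = 0")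
        case d: True
        have "change_of_basis (vector [1, 0, 0, 0]) (vector [0, 0, 1, 0]) (vector [0, 1, 0, 0])
            (vector [0, 0, 0, 1]) (triangular 0 1 0 0 c 1 d f g 0) (phi 11)"
          using 3 True d by (auto simp: basis_simps)
        then show ?thesis
          by (rule triangular_classified) simp
      next
        case False
        then have "1 / d * d + 1 / d * (1 / d) * (c * c) = 1"
          using True by simp
        from classified_central_pencil[OF this] show ?thesis
        unfolding 3 .
      qed
    next
      case False
      define t where "t = (csqrt (d * d + 4 * (c * c)) - d) / (2 * (c * c))"
      have "2 * (c * c) * t + d = csqrt (d * d + 4 * (c * c))"
        using False by (simp add: t_def)
      then have "(2 * (c * c) * t + d)\<^sup>2 = d * d + 4 * (c * c)"
        by simp
      then have "4 * (c * c) * (t * d + t * t * (c * c)) = 4 * (c * c) * 1"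
        by (simp add: power2_eq_square algebra_simps)
      then have "t * d + t * t * (c * c) = 1"
        using False by (subst (asm) mult_left_cancel) auto
      from classified_central_pencil[OF this] show ?thesis
        unfolding 3 .
    qed
  qed
qed

text \<open>
  The products of \<open>e\<^sub>1\<close> and \<open>e\<^sub>2\<close> are now diagonal modulo \<open>e\<^sub>4\<close>, and the Jordan identity at \<open>e\<^sub>1\<close> gives
  \<open>e\<^sub>3e\<^sub>3 = 0\<close>. If \<open>d\<^sub>3\<close> vanishes, exchanging \<open>e\<^sub>2\<close> and \<open>e\<^sub>3\<close> gives a law of \<open>classified_family\<close>.
\<close>

lemma classified_normalized:
  assumes jordan: "jordan_algebra (*s) (triangular 0 1 0 0 c d\<^sub>3 d f g h)"
  shows "classified (triangular 0 1 0 0 c d\<^sub>3 d f g h)"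
proof -
  have h: "h = 0"
    using jordan_algebra.jordan[OF jordan, of "e 1" "e 1"] by (simp add: triangular_def vec4_eq_iff)
  show ?thesis
  proof (cases "d\<^sub>3 = 0")
    case True
    have "change_of_basis (vector [1, 0, 0, 0]) (vector [0, 0, 1, 0]) (vector [0, 1, 0, 0])
        (vector [0, 0, 0, 1]) (triangular 0 1 0 0 c d\<^sub>3 d f g h) (triangular 1 0 0 0 f 0 0 c g d)"
      using True h by (auto simp: basis_simps)
    then show ?thesis
      by (rule classified_isomorphic[OF triangular_isomorphic classified_family])
  next
    case False
    obtain k where k: "1 = d\<^sub>3 * (k * k)"
      using exists_square_factor[OF False] by blast
    have "change_of_basis (vector [1, 0, 0, 0]) (vector [0, k, 0, 0]) (vector [0, 0, 1, 0])
        (vector [0, 0, 0, 1]) (triangular 0 1 0 0 c d\<^sub>3 d f g h)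
        (triangular 0 1 0 0 (k * c) 1 (k * k * d) f (k * g) 0)"
      using h k by (auto simp: basis_simps)
    then show ?thesis
      by (rule classified_isomorphic[OF triangular_isomorphic classified_two_squares])
  qed
qed

lemma triangular_jordan_transfer:
  assumes "jordan_algebra (*s) (triangular a\<^sub>2 a\<^sub>3 a\<^sub>4 c\<^sub>3 c\<^sub>4 d\<^sub>3 d\<^sub>4 f g h)"
    and "change_of_basis p q r s (triangular a\<^sub>2 a\<^sub>3 a\<^sub>4 c\<^sub>3 c\<^sub>4 d\<^sub>3 d\<^sub>4 f g h)
      (triangular a\<^sub>2' a\<^sub>3' a\<^sub>4' c\<^sub>3' c\<^sub>4' d\<^sub>3' d\<^sub>4' f' g' h')"
  shows "jordan_algebra (*s) (triangular a\<^sub>2' a\<^sub>3' a\<^sub>4' c\<^sub>3' c\<^sub>4' d\<^sub>3' d\<^sub>4' f' g' h')"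
  by (rule jordan_algebra_isomorphic[OF triangular_isomorphic[OF assms(2)] assms(1)])

text \<open>
  Complete the square: \<open>e\<^sub>1e\<^sub>1\<close> becomes the third basis vector, and a multiple of \<open>e\<^sub>1\<close> subtracted from
  \<open>e\<^sub>2\<close> removes the mixed term modulo \<open>e\<^sub>4\<close>.
\<close>

lemma classified_square_in_plane:
  assumes jordan: "jordan_algebra (*s) (triangular 0 a\<^sub>3 a\<^sub>4 c\<^sub>3 c\<^sub>4 d\<^sub>3 d\<^sub>4 f g h)"
    and a: "a\<^sub>3 \<noteq> 0"
  shows "classified (triangular 0 a\<^sub>3 a\<^sub>4 c\<^sub>3 c\<^sub>4 d\<^sub>3 d\<^sub>4 f g h)"
proof -
  obtain k where k: "c\<^sub>3 = a\<^sub>3 * k"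
    using exists_factor[OF a] by blast
  obtain m where "d\<^sub>3 - k * c\<^sub>3 = a\<^sub>3 * m"
    using exists_factor[OF a] by blast
  then have m: "d\<^sub>3 = a\<^sub>3 * m + k * (a\<^sub>3 * k)"
    by (simp add: k algebra_simps)
  have step: "change_of_basis (vector [1, 0, 0, 0]) (vector [- k, 1, 0, 0]) (vector [0, 0, a\<^sub>3, a\<^sub>4])
      (vector [0, 0, 0, 1]) (triangular 0 a\<^sub>3 a\<^sub>4 c\<^sub>3 c\<^sub>4 d\<^sub>3 d\<^sub>4 f g h)
      (triangular 0 1 0 0 (c\<^sub>4 - k * a\<^sub>4) m (d\<^sub>4 - 2 * k * c\<^sub>4 + k * k * a\<^sub>4 - m * a\<^sub>4)
        (a\<^sub>3 * f) (a\<^sub>3 * (g - k * f)) (a\<^sub>3 * a\<^sub>3 * h))"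
    using a by (auto simp: basis_simps k m algebra_simps)
  from classified_isomorphic[OF triangular_isomorphic[OF step] classified_normalized]
  show ?thesis
    using triangular_jordan_transfer[OF jordan step] by blast
qed

text \<open>
  The first four cases look for a vector whose square is not on the line of \<open>e\<^sub>4\<close>, among \<open>e\<^sub>1\<close>, \<open>e\<^sub>2\<close> and
  \<open>e\<^sub>1 + e\<^sub>2\<close>. In the last case all products lie on that line.
\<close>

lemma classified_triangular:
  assumes jordan: "jordan_algebra (*s) (triangular a\<^sub>2 a\<^sub>3 a\<^sub>4 c\<^sub>3 c\<^sub>4 d\<^sub>3 d\<^sub>4 f g h)"
    and "\<not> abelian (triangular a\<^sub>2 a\<^sub>3 a\<^sub>4 c\<^sub>3 c\<^sub>4 d\<^sub>3 d\<^sub>4 f g h)"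
  shows "classified (triangular a\<^sub>2 a\<^sub>3 a\<^sub>4 c\<^sub>3 c\<^sub>4 d\<^sub>3 d\<^sub>4 f g h)"
proof -
  let ?T = "triangular a\<^sub>2 a\<^sub>3 a\<^sub>4 c\<^sub>3 c\<^sub>4 d\<^sub>3 d\<^sub>4 f g h"
  have plane: "classified ?T" if "change_of_basis p q r s ?T (triangular 0 a\<^sub>3' a\<^sub>4' c\<^sub>3' c\<^sub>4' d\<^sub>3' d\<^sub>4' f' g' h')"
    "a\<^sub>3' \<noteq> 0" for p q r s a\<^sub>3' a\<^sub>4' c\<^sub>3' c\<^sub>4' d\<^sub>3' d\<^sub>4' f' g' h'
    using classified_isomorphic[OF triangular_isomorphic[OF that(1)] classified_square_in_plane]
      triangular_jordan_transfer[OF jordan that(1)] that(2) by blast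
  consider "a\<^sub>2 \<noteq> 0" | "a\<^sub>2 = 0" "a\<^sub>3 \<noteq> 0" | "a\<^sub>2 = 0" "d\<^sub>3 \<noteq> 0"
    | "a\<^sub>2 = 0" "a\<^sub>3 = 0" "d\<^sub>3 = 0" "c\<^sub>3 \<noteq> 0" | "a\<^sub>2 = 0" "a\<^sub>3 = 0" "d\<^sub>3 = 0" "c\<^sub>3 = 0"
    by blast
  then show ?thesis
  proof cases
    case 1
    have step: "change_of_basis (vector [1, 0, 0, 0]) (vector [0, a\<^sub>2, a\<^sub>3, a\<^sub>4]) (vector [0, 0, 1, 0])
        (vector [0, 0, 0, 1]) ?T
        (triangular 1 0 0 (a\<^sub>2 * c\<^sub>3) (a\<^sub>2 * c\<^sub>4 + a\<^sub>3 * f) (a\<^sub>2 * a\<^sub>2 * d\<^sub>3)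
          (a\<^sub>2 * a\<^sub>2 * d\<^sub>4 + 2 * a\<^sub>2 * a\<^sub>3 * g + a\<^sub>3 * a\<^sub>3 * h) f (a\<^sub>2 * g + a\<^sub>3 * h) h)"
      using 1 by (auto simp: basis_simps algebra_simps)
    from classified_isomorphic[OF triangular_isomorphic[OF step] classified_square_second]
    show ?thesis
      using triangular_jordan_transfer[OF jordan step] by blast
  next
    case 2
    then show ?thesis
      using classified_square_in_plane jordan by simp
  next
    case 3
    have "change_of_basis (vector [0, 1, 0, 0]) (vector [1, 0, 0, 0]) (vector [0, 0, 1, 0])
        (vector [0, 0, 0, 1]) ?T (triangular 0 d\<^sub>3 d\<^sub>4 c\<^sub>3 c\<^sub>4 a\<^sub>3 a\<^sub>4 g f h)"
      using 3 by (auto simp: basis_simps)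
    then show ?thesis
      using 3(2) by (rule plane)
  next
    case 4
    have "change_of_basis (vector [1, 1, 0, 0]) (vector [0, 1, 0, 0]) (vector [0, 0, 1, 0])
        (vector [0, 0, 0, 1]) ?T
        (triangular 0 (2 * c\<^sub>3) (a\<^sub>4 + 2 * c\<^sub>4 + d\<^sub>4) c\<^sub>3 (c\<^sub>4 + d\<^sub>4) 0 d\<^sub>4 (f + g) g h)"
      using 4 by (auto simp: basis_simps algebra_simps)
    then show ?thesis
      by (rule plane) (use 4 in simp)
  next
    case 5
    have "(a\<^sub>4, c\<^sub>4, d\<^sub>4, f, g, h) \<noteq> (0, 0, 0, 0, 0, 0)"
      using assms(2) 5 by (auto simp: abelian_def triangular_def vec4_eq_iff)
    then show ?thesis
      using classified_form 5 by simp
  qed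
qed

lemma nilpotent_jordan_classified:
  assumes "nilpotent_jordan_algebra smul \<phi>" "vector_space.dim smul UNIV = 4" "\<not> abelian \<phi>"
  shows "\<exists>i\<in>{1..12}. isomorphic_algebras smul \<phi> (*s) (phi i)"
proof -
  interpret jordan_algebra smul \<phi>
    using assms(1) by (simp add: nilpotent_jordan_algebra_def)
  obtain k where "central_seq smul \<phi> k = {0}"
    using assms(1) by (auto simp: nilpotent_jordan_algebra_def)
  from nilpotent_triangular_model[OF assms(2) this]
  obtain a\<^sub>2 a\<^sub>3 a\<^sub>4 c\<^sub>3 c\<^sub>4 d\<^sub>3 d\<^sub>4 f g h where iso:
    "isomorphic_algebras smul \<phi> (*s) (triangular a\<^sub>2 a\<^sub>3 a\<^sub>4 c\<^sub>3 c\<^sub>4 d\<^sub>3 d\<^sub>4 f g h)"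
    (is "isomorphic_algebras _ _ _ ?T")
    by blast
  have "\<not> abelian ?T"
  proof
    assume ab: "abelian ?T"
    obtain F where F: "Vector_Spaces.linear smul (*s) F" "bij F" "\<And>x y. F (\<phi> x y) = ?T (F x) (F y)"
      using iso unfolding isomorphic_algebras_def by blast
    interpret F: Vector_Spaces.linear smul "(*s)" F by (rule F(1))
    have "F (\<phi> x y) = F 0" for x y
      using ab by (simp add: abelian_def F(3) F.zero)
    then have "abelian \<phi>"
      using injD[OF bij_is_inj[OF F(2)]] unfolding abelian_def by blast
    with assms(3) show False ..
  qed
  then have "classified ?T"
    using jordan_algebra_isomorphic[OF iso jordan_algebra_axioms] classified_triangular by blast
  then show ?thesis
    using isomorphic_algebras_trans[OF iso] unfolding classified_def by blast
qed

section \<open>Orbit dimensions\<close>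

text \<open>
  The matrix entry \<open>M $ i $ j\<close> is the \<open>i\<close>-th coordinate of the image of \<open>e\<^sub>j\<close>.
\<close>

definition derivation :: "law4 \<Rightarrow> complex ^ 4 ^ 4 \<Rightarrow> bool" where
  "derivation \<psi> M \<longleftrightarrow> delta \<psi> ((*v) M) = 0"

lemma mult_e_component [simp]: "(M *v e j) $ i = M $ i $ j"
  using exhaust_4[of j] by (auto simp: matrix_vector_mult_def sum_4)

lemma comm_bilinear_delta:
  assumes "comm_bilinear \<psi>"
  shows "comm_bilinear (delta \<psi> ((*v) M))"
proof -
  have "\<psi> x y = \<psi> y x" for x y
    using assms by (simp add: comm_bilinear_def)
  then show ?thesis
    unfolding comm_bilinear_def
    by (intro conjI allI; (unfold_locales)?)
      (simp_all add: delta_def comm_bilinear_simps[OF assms] matrix_vector_right_distrib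
        vector_scalar_commute vec.scale_right_diff_distrib vec.scale_right_distrib algebra_simps)
qed

lemma derivation_iff:
  assumes bil: "comm_bilinear \<psi>"
  shows "derivation \<psi> M \<longleftrightarrow>
    (\<forall>(i, j) \<in> {(1, 1), (1, 2), (1, 3), (1, 4), (2, 2), (2, 3), (2, 4), (3, 3), (3, 4), (4, 4)}.
      \<psi> (M *v e i) (e j) + \<psi> (e i) (M *v e j) = M *v \<psi> (e i) (e j))"
    (is "_ \<longleftrightarrow> ?basis")
proof
  assume "derivation \<psi> M"
  then show ?basis
    by (auto simp: derivation_def delta_def fun_eq_iff)
next
  have comm: "\<psi> x y = \<psi> y x" for x y
    using bil by (simp add: comm_bilinear_def)
  assume basis: ?basis
  have "\<forall>i j. \<psi> (M *v e i) (e j) + \<psi> (e i) (M *v e j) = M *v \<psi> (e i) (e j)"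
    using basis unfolding forall_4
    by (simp add: comm[of "e 2" "e 1"] comm[of "e 3" "e 1"] comm[of "e 4" "e 1"] comm[of "e 3" "e 2"]
        comm[of "e 4" "e 2"] comm[of "e 4" "e 3"] comm[of "e _" "M *v _"] add.commute)
  then have eq: "delta \<psi> ((*v) M) (e i) (e j) = 0" for i j
    by (simp add: delta_def)
  show "derivation \<psi> M"
    unfolding derivation_def
  proof (intro ext)
    fix x y
    show "delta \<psi> ((*v) M) x y = 0 x y"
      using comm_bilinear_expand[OF comm_bilinear_delta[OF bil, of M], of x e y] by (simp add: eq flip: vec4_expansion)
  qed
qed


interpretation laws: vector_space "\<lambda>c (\<psi> :: law4) x y. c *s \<psi> x y"
  by unfold_locales (simp_all add: fun_eq_iff vector_add_ldistrib vector_sadd_rdistrib vector_smult_assoc)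

interpretation matrices: vector_space "\<lambda>c (M :: complex ^ 4 ^ 4). \<chi> i. c *s M $ i"
  by unfold_locales
    (simp_all add: Finite_Cartesian_Product.vec_eq_iff algebra_simps)

lemma orbit_tangent_space_eq: "orbit_tangent_space \<psi> = range (\<lambda>M. delta \<psi> ((*v) M))"
proof -
  have "\<exists>M. f = (*v) M" if "Vector_Spaces.linear (*s) (*s) f" for f :: "complex ^ 4 \<Rightarrow> complex ^ 4"
    using matrix_works[OF that] by (intro exI[of _ "matrix f"]) (simp add: fun_eq_iff)
  then show ?thesis
    unfolding orbit_tangent_space_def using matrix_vector_mul_linear_gen by blast
qed

text \<open>
  This is rank and nullity for \<open>M \<mapsto> \<delta>\<^sub>\<psi> M\<close>. The map \<open>R\<close> rewrites a matrix according to the solved form of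
  the equations for a derivation: entries in \<open>F\<close> are free and determine the others. Hence every
  matrix differs from a derivation by one supported outside \<open>F\<close>, and no nonzero derivation is
  supported there, so that the matrix units outside \<open>F\<close> map to a basis of the tangent space.
\<close>

lemma dim_orbit_derivations:
  fixes R :: "complex ^ 4 ^ 4 \<Rightarrow> complex ^ 4 ^ 4"
  assumes bil: "comm_bilinear \<psi>"
    and R: "\<And>M. derivation \<psi> M \<longleftrightarrow> M = R M"
    and free: "\<And>M i j. (i, j) \<in> F \<Longrightarrow> R M $ i $ j = M $ i $ j"
    and determined: "\<And>M N. (\<And>i j. (i, j) \<in> F \<Longrightarrow> M $ i $ j = N $ i $ j) \<Longrightarrow> R M = R N"
  shows "dim_orbit \<psi> = 16 - card F"
proof -
  define D where "D M = delta \<psi> ((*v) M)" for M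
  define U :: "4 \<times> 4 \<Rightarrow> complex ^ 4 ^ 4" where "U p = (\<chi> i j. if (i, j) = p then 1 else 0)" for p
  interpret D: Vector_Spaces.linear "\<lambda>c M. \<chi> i. c *s M $ i" "\<lambda>c \<psi> x y. c *s \<psi> x y" D
  proof unfold_locales
    show "D (M + N) = D M + D N" for M N
      by (simp add: D_def delta_def fun_eq_iff matrix_vector_mult_add_rdistrib comm_bilinear_simps[OF bil])
    have "(\<chi> i. c *s M $ i) *v x = c *s (M *v x)" for c x and M :: "complex ^ 4 ^ 4"
      by (simp add: vec4_eq_iff matrix_vector_mult_def sum_4 algebra_simps)
    then show "D (\<chi> i. c *s M $ i) = (\<lambda>x y. c *s D M x y)" for c M
      by (simp add: D_def delta_def fun_eq_iff comm_bilinear_simps[OF bil] vector_ssub_ldistrib vector_add_ldistrib)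
  qed
  have zero: "D M = 0 \<longleftrightarrow> M = R M" for M
    using R[of M] by (simp add: D_def derivation_def)
  have "D 0 = 0"
    by (rule D.zero)
  then have R0: "R 0 = 0"
    using zero[of 0] by simp
  have combination: "(\<Sum>p\<in>- F. (\<lambda>x y. c p *s D (U p) x y))
      = D (\<chi> i j. if (i, j) \<in> F then 0 else c (i, j))" for c
  proof -
    have "(\<chi> i j. if (i, j) \<in> F then 0 else c (i, j)) = (\<Sum>p\<in>- F. \<chi> i. c p *s U p $ i)"
      by (auto simp: Finite_Cartesian_Product.vec_eq_iff U_def if_distrib cong: if_cong)
    then show ?thesis
      by (simp add: D.sum D.scale)
  qed
  have independent: "c p = 0" if "(\<Sum>p\<in>- F. (\<lambda>x y. c p *s D (U p) x y)) = 0" "p \<notin> F" for c p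
  proof -
    let ?M = "\<chi> i j. if (i, j) \<in> F then 0 else c (i, j)"
    have "?M = R ?M"
      using that(1) zero unfolding combination by blast
    also have "\<dots> = R 0"
      by (rule determined) simp
    finally have "?M $ fst p $ snd p = 0"
      using R0 by simp
    then show ?thesis
      using that(2) by simp
  qed
  have "inj_on (\<lambda>p. D (U p)) (- F)"
  proof (rule inj_onI, rule ccontr)
    fix p q
    assume pq: "p \<in> - F" "q \<in> - F" "D (U p) = D (U q)" "p \<noteq> q"
    define c :: "4 \<times> 4 \<Rightarrow> complex" where "c r = (if r = p then 1 else if r = q then - 1 else 0)" for r
    have "(\<Sum>r\<in>- F. (\<lambda>x y. c r *s D (U r) x y)) = (\<Sum>r\<in>{p, q}. (\<lambda>x y. c r *s D (U r) x y))"
      by (rule sum.mono_neutral_right) (use pq in \<open>auto simp: c_def fun_eq_iff\<close>)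
    also have "\<dots> = 0"
      using pq by (simp add: c_def fun_eq_iff)
    finally show False
      using independent[of c p] pq(1) by (simp add: c_def)
  qed
  note inj = this
  have "laws.dim (range D) = card (- F)"
  proof (rule laws.dim_unique)
    show "(\<lambda>p. D (U p)) ` (- F) \<subseteq> range D"
      by blast
    show "card ((\<lambda>p. D (U p)) ` (- F)) = card (- F)"
      by (rule card_image[OF inj])
    show "laws.independent ((\<lambda>p. D (U p)) ` (- F))"
    proof
      assume "laws.dependent ((\<lambda>p. D (U p)) ` (- F))"
      then obtain c \<theta> where zero_sum: "(\<Sum>\<theta>\<in>(\<lambda>p. D (U p)) ` (- F). (\<lambda>x y. c \<theta> *s \<theta> x y)) = 0"
        and \<theta>: "\<theta> \<in> (\<lambda>p. D (U p)) ` (- F)" "c \<theta> \<noteq> 0"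
        by (auto simp: laws.dependent_finite simp del: ball_simps bex_simps)
      define b where "b p = c (D (U p))" for p
      have "(\<Sum>p\<in>- F. (\<lambda>x y. b p *s D (U p) x y)) = 0"
        using zero_sum by (simp add: sum.reindex[OF inj] b_def)
      moreover obtain p where p: "p \<notin> F" "\<theta> = D (U p)"
        using \<theta>(1) by blast
      ultimately have "b p = 0"
        using independent by blast
      then show False
        using \<theta>(2) by (simp add: p(2) b_def)
    qed
    show "range D \<subseteq> laws.span ((\<lambda>p. D (U p)) ` (- F))"
    proof (rule image_subsetI)
      fix M
      have "R M = R (R M)"
        by (rule determined) (simp add: free)
      then have "D (R M) = 0"
        using zero by blast
      then have "D M = D (M - R M)"
        by (simp add: D.diff)
      also have "M - R M = (\<chi> i j. if (i, j) \<in> F then 0 else (M - R M) $ fst (i, j) $ snd (i, j))"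
        by (auto simp: Finite_Cartesian_Product.vec_eq_iff free)
      also have "D \<dots> = (\<Sum>p\<in>- F. (\<lambda>x y. (M - R M) $ fst p $ snd p *s D (U p) x y))"
        by (rule combination[symmetric])
      also have "\<dots> \<in> laws.span ((\<lambda>p. D (U p)) ` (- F))"
        by (intro laws.span_sum laws.span_scale laws.span_base) auto
      finally show "D M \<in> laws.span ((\<lambda>p. D (U p)) ` (- F))" .
    qed
  qed
  moreover have "card (- F) = 16 - card F"
    by (simp add: Compl_eq_Diff_UNIV card_Diff_subset)
  ultimately show ?thesis
    unfolding dim_orbit_def orbit_tangent_space_eq by (simp add: D_def)
qed

lemmas derivation_simps =
  derivation_iff[OF comm_bilinear_phi] phi_components vec4_eq_iff matrix_vector_mult_def sum_4

text \<open>
  Complex linear equations are split into real and imaginary parts, where linear arithmetic applies.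
\<close>

lemma complex_linear_simps:
  "x = y \<longleftrightarrow> Re x = Re y \<and> Im x = Im y"
  "Re (numeral n * x) = numeral n * Re x" "Im (numeral n * x) = numeral n * Im x"
  "Re (x / numeral n) = Re x / numeral n" "Im (x / numeral n) = Im x / numeral n"
  by (auto simp: complex_eq_iff)

text \<open>
  In each of the following proofs the displayed matrix is the general derivation of the law, and the
  set lists its free entries.
\<close>

lemma dim_orbit_phi_1: "dim_orbit (phi 1) = 12"
proof -
  have "dim_orbit (phi 1) = 16 - card {(1, 1), (2, 1), (3, 1), (4, 1) :: 4 \<times> 4}"
  proof (rule dim_orbit_derivations)
    show "derivation (phi 1) M \<longleftrightarrow> M = vector [
        vector [M $ 1 $ 1, 0, 0, 0],
        vector [M $ 2 $ 1, 2 * M $ 1 $ 1, 0, 0],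
        vector [M $ 3 $ 1, 2 * M $ 2 $ 1, 3 * M $ 1 $ 1, 0],
        vector [M $ 4 $ 1, 2 * M $ 3 $ 1, 3 * M $ 2 $ 1, 4 * M $ 1 $ 1]]" for M
      by (rule iffI; simp add: derivation_simps; (simp add: complex_linear_simps)?)
  qed (auto simp: vec4_eq_iff comm_bilinear_phi)
  then show ?thesis
    by simp
qed

lemma dim_orbit_phi_2: "dim_orbit (phi 2) = 13"
proof -
  have "dim_orbit (phi 2) = 16 - card {(1, 1), (3, 1), (3, 4) :: 4 \<times> 4}"
  proof (rule dim_orbit_derivations)
    show "derivation (phi 2) M \<longleftrightarrow> M = vector [
        vector [M $ 1 $ 1, 0, 0, 0],
        vector [0, 2 * M $ 1 $ 1, 0, 0],
        vector [M $ 3 $ 1, 0, 3 * M $ 1 $ 1, M $ 3 $ 4],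
        vector [0, 0, 0, M $ 1 $ 1]]" for M
      by (rule iffI; simp add: derivation_simps; (simp add: complex_linear_simps)?)
  qed (auto simp: vec4_eq_iff comm_bilinear_phi)
  then show ?thesis
    by simp
qed

lemma dim_orbit_phi_3: "dim_orbit (phi 3) = 12"
proof -
  have "dim_orbit (phi 3) = 16 - card {(2, 1), (3, 1), (3, 4), (4, 1) :: 4 \<times> 4}"
  proof (rule dim_orbit_derivations)
    show "derivation (phi 3) M \<longleftrightarrow> M = vector [
        vector [- 3 * M $ 4 $ 1, 0, 0, M $ 4 $ 1],
        vector [M $ 2 $ 1, - 6 * M $ 4 $ 1, 0, M $ 4 $ 1 - M $ 2 $ 1],
        vector [M $ 3 $ 1, 2 * M $ 2 $ 1, - 8 * M $ 4 $ 1, M $ 3 $ 4],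
        vector [M $ 4 $ 1, 0, 0, - 3 * M $ 4 $ 1]]" for M
      by (rule iffI; simp add: derivation_simps; (simp add: complex_linear_simps)?)
  qed (auto simp: vec4_eq_iff comm_bilinear_phi)
  then show ?thesis
    by simp
qed

lemma dim_orbit_phi_4: "dim_orbit (phi 4) = 11"
proof -
  have "dim_orbit (phi 4) = 16 - card {(1, 1), (2, 1), (3, 1), (3, 4), (4, 1) :: 4 \<times> 4}"
  proof (rule dim_orbit_derivations)
    show "derivation (phi 4) M \<longleftrightarrow> M = vector [
        vector [M $ 1 $ 1, 0, 0, M $ 4 $ 1],
        vector [M $ 2 $ 1, 2 * M $ 1 $ 1, 0, - M $ 2 $ 1],
        vector [M $ 3 $ 1, 2 * M $ 2 $ 1, 3 * M $ 1 $ 1 + M $ 4 $ 1, M $ 3 $ 4],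
        vector [M $ 4 $ 1, 0, 0, M $ 1 $ 1]]" for M
      by (rule iffI; simp add: derivation_simps; (simp add: complex_linear_simps)?)
  qed (auto simp: vec4_eq_iff comm_bilinear_phi)
  then show ?thesis
    by simp
qed

lemma dim_orbit_phi_5: "dim_orbit (phi 5) = 12"
proof -
  have "dim_orbit (phi 5) = 16 - card {(1, 1), (3, 1), (3, 4), (4, 1) :: 4 \<times> 4}"
  proof (rule dim_orbit_derivations)
    show "derivation (phi 5) M \<longleftrightarrow> M = vector [
        vector [M $ 1 $ 1, 0, 0, 0],
        vector [0, 2 * M $ 1 $ 1, 0, 0],
        vector [M $ 3 $ 1, 0, 3 * M $ 1 $ 1 + M $ 4 $ 1, M $ 3 $ 4],
        vector [M $ 4 $ 1, 0, 0, M $ 1 $ 1 + M $ 4 $ 1]]" for M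
      by (rule iffI; simp add: derivation_simps; (simp add: complex_linear_simps)?)
  qed (auto simp: vec4_eq_iff comm_bilinear_phi)
  then show ?thesis
    by simp
qed

lemma dim_orbit_phi_6: "dim_orbit (phi 6) = 11"
proof -
  have "dim_orbit (phi 6) = 16 - card {(1, 1), (2, 1), (3, 1), (3, 4), (4, 1) :: 4 \<times> 4}"
  proof (rule dim_orbit_derivations)
    show "derivation (phi 6) M \<longleftrightarrow> M = vector [
        vector [M $ 1 $ 1, 0, 0, 0],
        vector [M $ 2 $ 1, 2 * M $ 1 $ 1, 0, - M $ 4 $ 1],
        vector [M $ 3 $ 1, 2 * M $ 2 $ 1, 3 * M $ 1 $ 1, M $ 3 $ 4],
        vector [M $ 4 $ 1, 0, 0, 3 * M $ 1 $ 1 / 2]]" for M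
      by (rule iffI; simp add: derivation_simps; (simp add: complex_linear_simps)?)
  qed (auto simp: vec4_eq_iff comm_bilinear_phi)
  then show ?thesis
    by simp
qed

lemma dim_orbit_phi_7: "dim_orbit (phi 7) = 10"
proof -
  have "dim_orbit (phi 7) = 16 - card {(1, 1), (2, 1), (3, 1), (3, 4), (4, 1), (4, 4) :: 4 \<times> 4}"
  proof (rule dim_orbit_derivations)
    show "derivation (phi 7) M \<longleftrightarrow> M = vector [
        vector [M $ 1 $ 1, 0, 0, 0],
        vector [M $ 2 $ 1, 2 * M $ 1 $ 1, 0, 0],
        vector [M $ 3 $ 1, 2 * M $ 2 $ 1, 3 * M $ 1 $ 1, M $ 3 $ 4],
        vector [M $ 4 $ 1, 0, 0, M $ 4 $ 4]]" for M
      by (rule iffI; simp add: derivation_simps; (simp add: complex_linear_simps)?)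
  qed (auto simp: vec4_eq_iff comm_bilinear_phi)
  then show ?thesis
    by simp
qed

lemma dim_orbit_phi_8: "dim_orbit (phi 8) = 10"
proof -
  have "dim_orbit (phi 8) = 16 - card {(1, 1), (2, 1), (2, 3), (4, 1), (4, 3), (4, 4) :: 4 \<times> 4}"
  proof (rule dim_orbit_derivations)
    show "derivation (phi 8) M \<longleftrightarrow> M = vector [
        vector [M $ 1 $ 1, 0, 0, 0],
        vector [M $ 2 $ 1, 2 * M $ 1 $ 1, M $ 2 $ 3, 0],
        vector [0, 0, M $ 4 $ 4 / 2, 0],
        vector [M $ 4 $ 1, 0, M $ 4 $ 3, M $ 4 $ 4]]" for M
      by (rule iffI; simp add: derivation_simps; (simp add: complex_linear_simps)?)
  qed (auto simp: vec4_eq_iff comm_bilinear_phi)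
  then show ?thesis
    by simp
qed

lemma dim_orbit_phi_9: "dim_orbit (phi 9) = 9"
proof -
  have "dim_orbit (phi 9) = 16 - card {(1, 1), (2, 1), (2, 3), (3, 1), (4, 1), (4, 3), (4, 4) :: 4 \<times> 4}"
  proof (rule dim_orbit_derivations)
    show "derivation (phi 9) M \<longleftrightarrow> M = vector [
        vector [M $ 1 $ 1, 0, 0, 0],
        vector [M $ 2 $ 1, 2 * M $ 1 $ 1, M $ 2 $ 3, 0],
        vector [M $ 3 $ 1, 0, M $ 4 $ 4 - M $ 1 $ 1, 0],
        vector [M $ 4 $ 1, 2 * M $ 3 $ 1, M $ 4 $ 3, M $ 4 $ 4]]" for M
      by (rule iffI; simp add: derivation_simps; (simp add: complex_linear_simps)?)
  qed (auto simp: vec4_eq_iff comm_bilinear_phi)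
  then show ?thesis
    by simp
qed

lemma dim_orbit_phi_10: "dim_orbit (phi 10) = 9"
proof -
  have "dim_orbit (phi 10) = 16 - card {(1, 1), (2, 1), (2, 3), (2, 4), (3, 1), (4, 1), (4, 4) :: 4 \<times> 4}"
  proof (rule dim_orbit_derivations)
    show "derivation (phi 10) M \<longleftrightarrow> M = vector [
        vector [M $ 1 $ 1, 0, - M $ 4 $ 1, - M $ 3 $ 1],
        vector [M $ 2 $ 1, 2 * M $ 1 $ 1, M $ 2 $ 3, M $ 2 $ 4],
        vector [M $ 3 $ 1, 0, 2 * M $ 1 $ 1 - M $ 4 $ 4, 0],
        vector [M $ 4 $ 1, 0, 0, M $ 4 $ 4]]" for M
      by (rule iffI; simp add: derivation_simps; (simp add: complex_linear_simps)?)
  qed (auto simp: vec4_eq_iff comm_bilinear_phi)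
  then show ?thesis
    by simp
qed

lemma dim_orbit_phi_11: "dim_orbit (phi 11) = 8"
proof -
  have "dim_orbit (phi 11) = 16 - card {(1, 1), (2, 1), (2, 3), (2, 4), (3, 1), (4, 1), (4, 3), (4, 4) :: 4 \<times> 4}"
  proof (rule dim_orbit_derivations)
    show "derivation (phi 11) M \<longleftrightarrow> M = vector [
        vector [M $ 1 $ 1, 0, - M $ 3 $ 1, 0],
        vector [M $ 2 $ 1, 2 * M $ 1 $ 1, M $ 2 $ 3, M $ 2 $ 4],
        vector [M $ 3 $ 1, 0, M $ 1 $ 1, 0],
        vector [M $ 4 $ 1, 0, M $ 4 $ 3, M $ 4 $ 4]]" for M
      by (rule iffI; simp add: derivation_simps; (simp add: complex_linear_simps)?)
  qed (auto simp: vec4_eq_iff comm_bilinear_phi)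
  then show ?thesis
    by simp
qed

lemma dim_orbit_phi_12: "dim_orbit (phi 12) = 6"
proof -
  have "dim_orbit (phi 12) = 16 - card {(1, 1), (2, 1), (2, 3), (2, 4), (3, 1), (3, 3), (3, 4), (4, 1), (4, 3), (4, 4) :: 4 \<times> 4}"
  proof (rule dim_orbit_derivations)
    show "derivation (phi 12) M \<longleftrightarrow> M = vector [
        vector [M $ 1 $ 1, 0, 0, 0],
        vector [M $ 2 $ 1, 2 * M $ 1 $ 1, M $ 2 $ 3, M $ 2 $ 4],
        vector [M $ 3 $ 1, 0, M $ 3 $ 3, M $ 3 $ 4],
        vector [M $ 4 $ 1, 0, M $ 4 $ 3, M $ 4 $ 4]]" for M
      by (rule iffI; simp add: derivation_simps; (simp add: complex_linear_simps)?)
  qed (auto simp: vec4_eq_iff comm_bilinear_phi)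
  then show ?thesis
    by simp
qed

lemmas dim_orbit_phi =
  dim_orbit_phi_1 dim_orbit_phi_2 dim_orbit_phi_3 dim_orbit_phi_4 dim_orbit_phi_5 dim_orbit_phi_6
  dim_orbit_phi_7 dim_orbit_phi_8 dim_orbit_phi_9 dim_orbit_phi_10 dim_orbit_phi_11 dim_orbit_phi_12

section \<open>Characteristic sequences\<close>

lemma less_4_cases: "i < (4 :: nat) \<longleftrightarrow> i = 0 \<or> i = 1 \<or> i = 2 \<or> i = 3"
  by auto

lemma diag_block_mat_zero:
  assumes "\<And>i j. i < dim_row (diag_block_mat As) \<Longrightarrow> j < dim_col (diag_block_mat As) \<Longrightarrow> diag_block_mat As $$ (i, j) = 0"
    and "A \<in> set As" "i < dim_row A" "j < dim_col A"
  shows "A $$ (i, j) = (0 :: 'a :: zero)"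
  using assms
proof (induction As)
  case (Cons B As)
  let ?D = "diag_block_mat As"
  have entry: "diag_block_mat (B # As) $$ (k, l) = (if k < dim_row B then if l < dim_col B then B $$ (k, l) else 0
      else if l < dim_col B then 0 else ?D $$ (k - dim_row B, l - dim_col B))"
    if "k < dim_row B + dim_row ?D" "l < dim_col B + dim_col ?D" for k l
    using that by (auto simp: Let_def)
  have dims: "dim_row (diag_block_mat (B # As)) = dim_row B + dim_row ?D"
    "dim_col (diag_block_mat (B # As)) = dim_col B + dim_col ?D"
    by (simp_all add: Let_def)
  show ?case
  proof (cases "A = B")
    case True
    then show ?thesis
      using Cons.prems(1)[of i j] Cons.prems(3,4) entry[of i j] dims by simp
  next
    case False
    show ?thesis
    proof (rule Cons.IH)
      show "?D $$ (k, l) = 0" if "k < dim_row ?D" "l < dim_col ?D" for k l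
        using Cons.prems(1)[of "dim_row B + k" "dim_col B + l"] that entry[of "dim_row B + k" "dim_col B + l"] dims
        by simp
    qed (use Cons.prems False in auto)
  qed
qed simp

text \<open>
  The \<open>k\<close>-th power of a Jordan block of size \<open>m > k\<close> has a 1 on its \<open>k\<close>-th superdiagonal, whatever the
  eigenvalue.
\<close>

lemma jordan_nf_nilpotent_block_size:
  fixes A :: "'a :: comm_ring_1 mat"
  assumes A: "A \<in> carrier_mat n n" and nil: "A ^\<^sub>m k = 0\<^sub>m n n"
    and jnf: "jordan_nf A n_as" and block: "(m, a) \<in> set n_as"
  shows "m \<le> k"
proof (rule ccontr)
  assume "\<not> m \<le> k"
  then have m: "k < m" by simp
  obtain n' P Q where PQ: "{A, jordan_matrix n_as, P, Q} \<subseteq> carrier_mat n' n'"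
    "P * Q = 1\<^sub>m n'" "Q * P = 1\<^sub>m n'" "A = P * jordan_matrix n_as * Q"
    using similar_matD jnf unfolding jordan_nf_def by metis
  then have "n' = n"
    using A by auto
  note PQ = PQ[unfolded this]
  have "similar_mat_wit (jordan_matrix n_as) A Q P"
    by (rule similar_mat_wit_sym) (use PQ in \<open>auto simp: similar_mat_wit_def Let_def\<close>)
  then have "jordan_matrix n_as ^\<^sub>m k = Q * A ^\<^sub>m k * P"
    using similar_mat_wit_pow[of _ A Q P k] by (auto simp: similar_mat_wit_def Let_def)
  then have "jordan_matrix n_as ^\<^sub>m k = 0\<^sub>m n n"
    using PQ(1) right_mult_zero_mat[of Q n n n] left_mult_zero_mat[of P n n n] by (simp add: nil)
  then have zero: "diag_block_mat (map (\<lambda>(m, a). jordan_block m a ^\<^sub>m k) n_as) = 0\<^sub>m n n"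
    unfolding jordan_matrix_pow .
  have "(jordan_block m a ^\<^sub>m k) $$ (0, k) = 0"
  proof (rule diag_block_mat_zero[of "map (\<lambda>(m, a). jordan_block m a ^\<^sub>m k) n_as"])
    show "jordan_block m a ^\<^sub>m k \<in> set (map (\<lambda>(m, a). jordan_block m a ^\<^sub>m k) n_as)"
      using block by force
  qed (use m zero in simp_all)
  then show False
    using m by (simp add: jordan_block_pow)
qed

lemma jordan_nf_dim:
  assumes "A \<in> carrier_mat n n" "jordan_nf A n_as"
  shows "sum_list (map fst n_as) = n"
proof -
  obtain n' where "A \<in> carrier_mat n' n'" "jordan_matrix n_as \<in> carrier_mat n' n'"
    using similar_matD assms(2) unfolding jordan_nf_def by (metis insert_subset)
  then show ?thesis
    using assms(1) by (metis carrier_matD(1) jordan_matrix_dim(1))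
qed

text \<open>
  A matrix similar to \<open>U * V\<close> is again a column times a row, so all its \<open>2 \<times> 2\<close> minors vanish. With two
  blocks of size 2, the minor with rows 0, 2 and columns 1, 3 is 1.
\<close>

lemma jordan_nf_rank_one:
  fixes U V :: "'a :: comm_ring_1 mat"
  assumes U: "U \<in> carrier_mat 4 1" and V: "V \<in> carrier_mat 1 4" and jnf: "jordan_nf (U * V) n_as"
  shows "map fst n_as \<noteq> [2, 2]"
proof
  assume "map fst n_as = [2, 2]"
  then obtain a b where n_as: "n_as = [(2, a), (2, b)]"
    by (auto simp: map_eq_Cons_conv)
  obtain n P Q where PQ: "{U * V, jordan_matrix n_as, P, Q} \<subseteq> carrier_mat n n"
    "P * Q = 1\<^sub>m n" "Q * P = 1\<^sub>m n" "U * V = P * jordan_matrix n_as * Q"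
    using similar_matD jnf unfolding jordan_nf_def by metis
  have "U * V \<in> carrier_mat 4 4"
    using U V by simp
  then have "n = 4"
    using PQ(1) by auto
  note PQ = PQ[unfolded this]
  have "similar_mat_wit (jordan_matrix n_as) (U * V) Q P"
    by (rule similar_mat_wit_sym) (use PQ in \<open>auto simp: similar_mat_wit_def Let_def\<close>)
  then have "jordan_matrix n_as = Q * (U * V) * P"
    by (simp add: similar_mat_wit_def Let_def)
  also have "\<dots> = (Q * U) * (V * P)"
    using PQ(1) U V assoc_mult_mat[of Q 4 4 "U * V" 4 P 4] assoc_mult_mat[of U 4 1 V 4 P 4]
      assoc_mult_mat[of Q 4 4 U 1 "V * P" 4] by simp
  finally have J: "jordan_matrix n_as = (Q * U) * (V * P)" .
  have entry: "jordan_matrix n_as $$ (i, j) = (Q * U) $$ (i, 0) * (V * P) $$ (0, j)" if "i < 4" "j < 4" for i j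
  proof -
    have "Q \<in> carrier_mat 4 4" "P \<in> carrier_mat 4 4"
      using PQ(1) by simp_all
    from this[THEN carrier_matD(1)] this[THEN carrier_matD(2)] show ?thesis
      unfolding J using that carrier_matD[OF U] carrier_matD[OF V] by (simp add: scalar_prod_def One_nat_def)
  qed
  have swap: "a * b * (c * d) = a * d * (c * b)" for a b c d :: 'a
    by (metis mult.assoc mult.commute)
  have "jordan_matrix n_as $$ (0, 1) * jordan_matrix n_as $$ (2, 3)
      = (Q * U) $$ (0, 0) * (V * P) $$ (0, 1) * ((Q * U) $$ (2, 0) * (V * P) $$ (0, 3))"
    by (simp add: entry)
  also have "\<dots> = (Q * U) $$ (0, 0) * (V * P) $$ (0, 3) * ((Q * U) $$ (2, 0) * (V * P) $$ (0, 1))"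
    by (rule swap)
  also have "\<dots> = jordan_matrix n_as $$ (0, 3) * jordan_matrix n_as $$ (2, 1)"
    by (simp add: entry)
  finally have "jordan_matrix n_as $$ (0, 1) * jordan_matrix n_as $$ (2, 3)
      = jordan_matrix n_as $$ (0, 3) * jordan_matrix n_as $$ (2, 1)" .
  then show False
    by (simp add: n_as jordan_matrix_def Let_def One_nat_def)
qed

text \<open>
  The permutation matrix of an involution is its own inverse; involutions suffice to reverse chains of
  basis vectors.
\<close>

lemma similar_mat_permutation:
  fixes A J :: "'a :: comm_ring_1 mat"
  assumes A: "A \<in> carrier_mat n n" and J: "J \<in> carrier_mat n n"
    and \<sigma>: "\<And>i. i < n \<Longrightarrow> \<sigma> i < n" "\<And>i. i < n \<Longrightarrow> \<sigma> (\<sigma> i) = i"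
    and entries: "\<And>i j. i < n \<Longrightarrow> j < n \<Longrightarrow> A $$ (i, j) = J $$ (\<sigma> i, \<sigma> j)"
  shows "similar_mat A J"
proof -
  define P :: "'a mat" where "P = Matrix.mat n n (\<lambda>(i, j). if j = \<sigma> i then 1 else 0)"
  have P: "P \<in> carrier_mat n n"
    by (simp add: P_def)
  have left: "(P * M) $$ (i, j) = M $$ (\<sigma> i, j)" if "M \<in> carrier_mat n n" "i < n" "j < n" for M i j
    using that \<sigma> by (simp add: P_def scalar_prod_def if_distrib[of "\<lambda>x. x * _"] cong: if_cong)
  have right: "(M * P) $$ (i, j) = M $$ (i, \<sigma> j)" if "M \<in> carrier_mat n n" "i < n" "j < n" for M i j
  proof -
    have "(M * P) $$ (i, j) = (\<Sum>k = 0..<n. M $$ (i, k) * (if j = \<sigma> k then 1 else 0))"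
      using that by (simp add: P_def scalar_prod_def)
    also have "\<dots> = (\<Sum>k = 0..<n. if k = \<sigma> j then M $$ (i, k) else 0)"
      by (rule sum.cong) (use \<sigma> that in auto)
    finally show ?thesis
      using that \<sigma> by simp
  qed
  have PP: "P * P = 1\<^sub>m n"
  proof (rule eq_matI)
    fix i j
    assume "i < dim_row (1\<^sub>m n :: 'a mat)" "j < dim_col (1\<^sub>m n :: 'a mat)"
    then have ij: "i < n" "j < n"
      by simp_all
    then have "(P * P) $$ (i, j) = P $$ (\<sigma> i, j)"
      by (rule left[OF P])
    also have "\<dots> = 1\<^sub>m n $$ (i, j)"
      using ij \<sigma> by (auto simp: P_def)
    finally show "(P * P) $$ (i, j) = 1\<^sub>m n $$ (i, j)" .
  qed (use P in auto)
  have AP: "A = P * J * P"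
  proof (rule eq_matI)
    fix i j
    assume "i < dim_row (P * J * P)" "j < dim_col (P * J * P)"
    then have ij: "i < n" "j < n"
      using P by simp_all
    have "P * J \<in> carrier_mat n n"
      using P J by simp
    then show "A $$ (i, j) = (P * J * P) $$ (i, j)"
      using ij \<sigma> by (simp add: right left[OF J] entries)
  qed (use A P in auto)
  have "similar_mat_wit A J P P"
    unfolding similar_mat_wit_def Let_def using A J P PP AP by (simp add: carrier_matD(1)[OF A])
  then show ?thesis
    unfolding similar_mat_def by blast
qed

lemma matrix4_carrier [simp]: "matrix4 f \<in> carrier_mat 4 4" "dim_row (matrix4 f) = 4" "dim_col (matrix4 f) = 4"
  by (simp_all add: matrix4_def)

lemma matrix4_compose:
  assumes "Vector_Spaces.linear (*s) (*s) f"
  shows "matrix4 f * matrix4 g = matrix4 (f \<circ> g)"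
proof (rule eq_matI)
  interpret Vector_Spaces.linear "(*s)" "(*s)" f by fact
  fix i j
  assume "i < dim_row (matrix4 (f \<circ> g))" "j < dim_col (matrix4 (f \<circ> g))"
  then have ij: "i < 4" "j < 4"
    by simp_all
  let ?x = "g (e (of_nat (Suc j)))"
  have "f ?x = (\<Sum>k\<in>UNIV. ?x $ k *s f (e k))"
    by (subst vec4_expansion[of ?x]) (simp add: sum scale)
  then show "(matrix4 f * matrix4 g) $$ (i, j) = matrix4 (f \<circ> g) $$ (i, j)"
    using ij by (simp add: matrix4_def scalar_prod_def sum_4 numeral_eq_Suc atLeast0LessThan lessThan_Suc)
qed simp_all

lemma matrix4_zero: "matrix4 (\<lambda>x. 0) = 0\<^sub>m 4 4"
  by (rule eq_matI) (simp_all add: matrix4_def)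

text \<open>
  Listed in decreasing lexicographic order, so that an upper bound for the characteristic sequence
  means excluding the first few partitions.
\<close>

lemma partitions_of_4:
  assumes "sum_list s = (4 :: nat)" "0 \<notin> set s" "sorted (rev s)"
  shows "s \<in> {[4], [3, 1], [2, 2], [2, 1, 1], [1, 1, 1, 1]}"
proof -
  have "length s \<le> sum_list s"
    using assms(2) by (induction s) auto
  then have "length s \<le> 4"
    using assms(1) by simp
  then consider "s = []" | a where "s = [a]" | a b where "s = [a, b]" | a b c where "s = [a, b, c]"
    | a b c d where "s = [a, b, c, d]"
    by (auto simp: le_Suc_eq numeral_eq_Suc length_Suc_conv One_nat_def)
  then show ?thesis
  proof cases
    case (3 a b)
    then have "a = 3 \<or> a = 2" using assms by auto
    then show ?thesis using 3 assms by auto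
  next
    case (4 a b c)
    then have "a = 2 \<and> b = 1" using assms by auto
    then show ?thesis using 4 assms by auto
  next
    case (5 a b c d)
    then have "a = 1 \<and> b = 1 \<and> c = 1" using assms by auto
    then show ?thesis using 5 assms by auto
  qed (use assms in auto)
qed

lemma jordan_sizes_partition:
  assumes "jordan_sizes_at \<psi> x s"
  shows "s \<in> {[4], [3, 1], [2, 2], [2, 1, 1], [1, 1, 1, 1]}"
proof -
  obtain n_as where jnf: "jordan_nf (matrix4 (\<psi> x)) n_as" and s: "s = rev (sort (map fst n_as))"
    using assms unfolding jordan_sizes_at_def by blast
  have "sum_list s = sum_list (map fst n_as)"
    unfolding s sum_list_rev by (metis mset_sort sum_mset_sum_list)
  then have "sum_list s = 4"
    using jordan_nf_dim[OF matrix4_carrier(1) jnf] by simp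
  moreover have "0 \<notin> set s"
    using jnf by (auto simp: s jordan_nf_def)
  ultimately show ?thesis
    using partitions_of_4[of s] by (simp add: s)
qed

lemma jordan_sizes_nilpotent:
  assumes "jordan_sizes_at \<psi> x s" "matrix4 (\<psi> x) ^\<^sub>m k = 0\<^sub>m 4 4" "m \<in> set s"
  shows "m \<le> k"
  using assms jordan_nf_nilpotent_block_size[OF matrix4_carrier(1)]
  by (auto simp: jordan_sizes_at_def)

lemma jordan_sizes_rank_one:
  assumes s: "jordan_sizes_at \<psi> x s" and rank: "\<And>y. \<psi> x y = l y *s v"
  shows "s \<noteq> [2, 2]"
proof
  assume "s = [2, 2]"
  then obtain n_as where jnf: "jordan_nf (matrix4 (\<psi> x)) n_as" and "[2, 2] = rev (sort (map fst n_as))"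
    using s unfolding jordan_sizes_at_def by blast
  then have "mset (map fst n_as) = {#2, 2#}"
    by (metis mset_rev mset_sort mset.simps add_mset_commute)
  then have "map fst n_as = [2, 2]"
    by (cases "map fst n_as") (auto simp: add_eq_conv_ex)
  moreover have "matrix4 (\<psi> x) = Matrix.mat 4 1 (\<lambda>(i, j). v $ of_nat (Suc i))
      * Matrix.mat 1 4 (\<lambda>(i, j). l (e (of_nat (Suc j))))"
    by (rule eq_matI) (simp_all add: matrix4_def rank scalar_prod_def One_nat_def mult.commute)
  ultimately show False
    using jordan_nf_rank_one[of "Matrix.mat 4 1 (\<lambda>(i, j). v $ of_nat (Suc i))"
        "Matrix.mat 1 4 (\<lambda>(i, j). l (e (of_nat (Suc j))))" n_as] jnf by auto
qed

lemma has_char_seqI: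
  assumes "x \<notin> central_seq (*s) \<psi> 2" "0 \<in> central_seq (*s) \<psi> 2" "jordan_sizes_at \<psi> x s"
    and "\<And>x s'. jordan_sizes_at \<psi> x s' \<Longrightarrow> s' \<le> s"
  shows "has_char_seq \<psi> s"
  unfolding has_char_seq_def
proof (rule isLubI2)
  have "x \<noteq> 0"
    using assms(1,2) by auto
  show "isUb UNIV {s'. \<exists>x. x \<noteq> 0 \<and> x \<notin> central_seq (*s) \<psi> 2 \<and> jordan_sizes_at \<psi> x s'} s"
    using assms(4) by (auto intro!: isUbI setleI)
  show "s <=* Collect (isUb UNIV {s'. \<exists>x. x \<noteq> 0 \<and> x \<notin> central_seq (*s) \<psi> 2 \<and> jordan_sizes_at \<psi> x s'})"
    using assms(1,3) \<open>x \<noteq> 0\<close> by (intro setgeI ballI isUbD) auto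
qed


lemma phi_char_seqI:
  assumes i: "i \<in> {1..12}" and x: "x $ 1 \<noteq> 0" and sizes: "jordan_sizes_at (phi i) x s"
    and upper: "\<And>x s'. jordan_sizes_at (phi i) x s' \<Longrightarrow> s' \<le> s"
  shows "has_char_seq (phi i) s"
proof (rule has_char_seqI[OF _ _ sizes upper])
  interpret jordan_algebra "(*s)" "phi i"
    using i by (rule phi_jordan_algebra)
  have "phi i x y $ 1 = 0" for x y
    using i by (induction i rule: index_induct) (simp_all add: phi_components)
  moreover have "vec.subspace {x :: complex ^ 4. x $ 1 = 0}"
    by (simp add: vec.subspace_def)
  ultimately have "central_seq (*s) (phi i) (Suc 1) \<subseteq> {x. x $ 1 = 0}"
    unfolding One_nat_def by (intro central_seq_Suc_subset) auto
  then show "x \<notin> central_seq (*s) (phi i) 2"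
    using x by (auto simp: numeral_2_eq_2 One_nat_def)
  show "0 \<in> central_seq (*s) (phi i) 2"
    using subspace_central_seq by (rule vec.subspace_0)
qed

lemma jordan_sizes_by_permutation:
  assumes "\<And>i. i < 4 \<Longrightarrow> \<sigma> i < 4" "\<And>i. i < 4 \<Longrightarrow> \<sigma> (\<sigma> i) = i"
    and "sum_list (map fst n_as) = 4" "0 \<notin> fst ` set n_as"
    and "\<And>i j. i < 4 \<Longrightarrow> j < 4 \<Longrightarrow>
      \<psi> x (e (of_nat (Suc j))) $ of_nat (Suc i) = jordan_matrix n_as $$ (\<sigma> i, \<sigma> j)"
    and "rev (sort (map fst n_as)) = s"
  shows "jordan_sizes_at \<psi> x s"
proof -
  have "similar_mat (matrix4 (\<psi> x)) (jordan_matrix n_as)"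
  proof (rule similar_mat_permutation)
    show "jordan_matrix n_as \<in> carrier_mat 4 4"
      using jordan_matrix_carrier[of n_as] assms(3) by simp
    show "matrix4 (\<psi> x) $$ (i, j) = jordan_matrix n_as $$ (\<sigma> i, \<sigma> j)" if "i < 4" "j < 4" for i j
      using that assms(5) by (simp add: matrix4_def)
  qed (use assms(1,2) in simp_all)
  then show ?thesis
    using assms(4,6) unfolding jordan_sizes_at_def jordan_nf_def by blast
qed

text \<open>
  The permutations here and below reverse each chain of basis vectors under \<open>L\<^sub>x\<close>, since a Jordan
  block maps each basis vector to the preceding one.
\<close>

lemma phi_jordan_sizes_4: "jordan_sizes_at (phi 1) (e 1) [4]"
  by (rule jordan_sizes_by_permutation[where \<sigma> = "\<lambda>i. 3 - i" and n_as = "[(4, 0)]"])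
    (auto simp: less_4_cases phi_components jordan_matrix_def Let_def)

lemma phi_jordan_sizes_3_1:
  "i \<in> {2, 3, 4, 5, 6, 7} \<Longrightarrow> jordan_sizes_at (phi i) (e 1) [3, 1]"
  by (rule jordan_sizes_by_permutation[where \<sigma> = "\<lambda>i. if i < 3 then 2 - i else i" and n_as = "[(3, 0), (1, 0)]"])
    (auto simp: less_4_cases phi_components jordan_matrix_def Let_def)

lemma phi_jordan_sizes_2_2:
  "i \<in> {8, 9} \<Longrightarrow> jordan_sizes_at (phi i) (if i = 8 then e 1 + e 3 else e 1) [2, 2]"
  by (rule jordan_sizes_by_permutation[where \<sigma> = "\<lambda>i. if even i then i + 1 else i - 1" and n_as = "[(2, 0), (2, 0)]"])
    (auto simp: less_4_cases phi_components jordan_matrix_def Let_def)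

lemma phi_jordan_sizes_2_1_1:
  "i \<in> {10, 11, 12} \<Longrightarrow> jordan_sizes_at (phi i) (e 1) [2, 1, 1]"
  by (rule jordan_sizes_by_permutation[where \<sigma> = "\<lambda>i. if i < 2 then 1 - i else i" and n_as = "[(2, 0), (1, 0), (1, 0)]"])
    (auto simp: less_4_cases phi_components jordan_matrix_def Let_def)

lemma has_char_seq_phi_1: "has_char_seq (phi 1) [4]"
proof (rule phi_char_seqI[OF _ _ phi_jordan_sizes_4])
  show "s' \<le> [4]" if "jordan_sizes_at (phi 1) x s'" for x s'
    using jordan_sizes_partition[OF that] by auto
qed simp_all

lemma has_char_seq_phi_3_1:
  assumes "i \<in> {2, 3, 4, 5, 6, 7}"
  shows "has_char_seq (phi i) [3, 1]"
proof (rule phi_char_seqI[OF _ _ phi_jordan_sizes_3_1[OF assms]])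
  show "s' \<le> [3, 1]" if s': "jordan_sizes_at (phi i) x s'" for x s'
  proof -
    have "phi i x (phi i x (phi i x y)) = 0" for y
      using assms by (auto simp: phi_components vec4_eq_iff)
    then have "phi i x \<circ> phi i x \<circ> phi i x = (\<lambda>y. 0)"
      by (simp add: fun_eq_iff)
    then have "matrix4 (phi i x) ^\<^sub>m 3 = 0\<^sub>m 4 4"
      by (simp add: numeral_3_eq_3 matrix4_compose[OF phi_linear] matrix4_zero
          matrix4_compose[OF Vector_Spaces.linear_compose[OF phi_linear phi_linear]])
    from jordan_sizes_nilpotent[OF s' this, of 4] show ?thesis
      using jordan_sizes_partition[OF s'] by auto
  qed
qed (use assms in auto)

lemma phi_square_zero:
  assumes "i \<in> {8, 9, 10, 11, 12}"
  shows "matrix4 (phi i x) ^\<^sub>m 2 = 0\<^sub>m 4 4"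
proof -
  have "phi i x (phi i x y) = 0" for y
    using assms by (auto simp: phi_components vec4_eq_iff)
  then show ?thesis
    by (simp add: numeral_2_eq_2 matrix4_compose[OF phi_linear] comp_def flip: matrix4_zero)
qed

lemma has_char_seq_phi_2_2:
  assumes "i \<in> {8, 9}"
  shows "has_char_seq (phi i) [2, 2]"
proof (rule phi_char_seqI[OF _ _ phi_jordan_sizes_2_2[OF assms]])
  show "s' \<le> [2, 2]" if s': "jordan_sizes_at (phi i) x s'" for x s'
    using jordan_sizes_nilpotent[OF s' phi_square_zero, of 4] jordan_sizes_nilpotent[OF s' phi_square_zero, of 3]
      jordan_sizes_partition[OF s'] assms by auto
qed (use assms in auto)

lemma has_char_seq_phi_2_1_1:
  assumes "i \<in> {10, 11, 12}"
  shows "has_char_seq (phi i) [2, 1, 1]"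
proof (rule phi_char_seqI[OF _ _ phi_jordan_sizes_2_1_1[OF assms]])
  show "s' \<le> [2, 1, 1]" if s': "jordan_sizes_at (phi i) x s'" for x s'
  proof -
    have "phi i x y = phi i x y $ 2 *s e 2" for y
      using assms by (auto simp: phi_components vec4_eq_iff)
    from jordan_sizes_rank_one[OF s' this] show ?thesis
      using jordan_sizes_nilpotent[OF s' phi_square_zero, of 4] jordan_sizes_nilpotent[OF s' phi_square_zero, of 3]
        jordan_sizes_partition[OF s'] assms by auto
  qed
qed (use assms in auto)

section \<open>Centers and pairwise non-isomorphism\<close>

lemma center_eq:
  assumes "comm_bilinear \<psi>"
  shows "center \<psi> = {x. \<forall>j. \<psi> x (e j) = 0}"
proof -
  have "\<psi> x y = 0" if "\<forall>j. \<psi> x (e j) = 0" for x y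
    using that by (subst vec4_expansion[of y]) (simp add: comm_bilinear_simps[OF assms])
  then show ?thesis
    by (auto simp: center_def)
qed

lemma center_phi:
  "center (phi 1) = {x. \<forall>i. i \<notin> {4} \<longrightarrow> x $ i = 0}"
  "center (phi 2) = {x. \<forall>i. i \<notin> {3} \<longrightarrow> x $ i = 0}"
  "center (phi 3) = {x. \<forall>i. i \<notin> {3} \<longrightarrow> x $ i = 0}"
  "center (phi 4) = {x. \<forall>i. i \<notin> {3} \<longrightarrow> x $ i = 0}"
  "center (phi 5) = {x. \<forall>i. i \<notin> {3} \<longrightarrow> x $ i = 0}"
  "center (phi 6) = {x. \<forall>i. i \<notin> {3} \<longrightarrow> x $ i = 0}"
  "center (phi 7) = {x. \<forall>i. i \<notin> {3, 4} \<longrightarrow> x $ i = 0}"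
  "center (phi 8) = {x. \<forall>i. i \<notin> {2, 4} \<longrightarrow> x $ i = 0}"
  "center (phi 9) = {x. \<forall>i. i \<notin> {2, 4} \<longrightarrow> x $ i = 0}"
  "center (phi 10) = {x. \<forall>i. i \<notin> {2} \<longrightarrow> x $ i = 0}"
  "center (phi 11) = {x. \<forall>i. i \<notin> {2, 4} \<longrightarrow> x $ i = 0}"
  "center (phi 12) = {x. \<forall>i. i \<notin> {2, 3, 4} \<longrightarrow> x $ i = 0}"
  by (auto simp: center_eq[OF comm_bilinear_phi] forall_4 phi_components vec4_eq_iff)

lemma dim_center_phi:
  "vec.dim (center (phi 1)) = 1" "vec.dim (center (phi 2)) = 1" "vec.dim (center (phi 3)) = 1"
  "vec.dim (center (phi 4)) = 1" "vec.dim (center (phi 5)) = 1" "vec.dim (center (phi 6)) = 1"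
  "vec.dim (center (phi 7)) = 2" "vec.dim (center (phi 8)) = 2" "vec.dim (center (phi 9)) = 2"
  "vec.dim (center (phi 10)) = 1" "vec.dim (center (phi 11)) = 2" "vec.dim (center (phi 12)) = 3"
  unfolding center_phi dim_substandard_cart by simp_all

lemma isomorphism_center_iff:
  assumes "bij f" "\<And>x y. f (\<phi> x y) = \<psi> (f x) (f y)" "f 0 = 0"
  shows "f x \<in> center \<psi> \<longleftrightarrow> x \<in> center \<phi>"
proof -
  have "f (\<phi> x y) = 0 \<longleftrightarrow> \<phi> x y = 0" for y
    using assms(1,3) by (metis bij_is_inj injD)
  moreover have "(\<forall>y. \<psi> (f x) y = 0) \<longleftrightarrow> (\<forall>y. \<psi> (f x) (f y) = 0)"
    using assms(1) by (metis bij_is_surj surjE)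
  ultimately show ?thesis
    by (simp add: center_def assms(2))
qed

lemma dim_center_isomorphic:
  assumes "isomorphic_algebras (*s) \<phi> (*s) (\<psi> :: law4)"
  shows "vec.dim (center \<phi>) = vec.dim (center \<psi>)"
proof -
  obtain f where f: "Vector_Spaces.linear (*s) (*s) f" "bij f" "\<And>x y. f (\<phi> x y) = \<psi> (f x) (f y)"
    using assms unfolding isomorphic_algebras_def by blast
  interpret f: Vector_Spaces.linear "(*s)" "(*s)" f by (rule f(1))
  have center: "f x \<in> center \<psi> \<longleftrightarrow> x \<in> center \<phi>" for x
    by (rule isomorphism_center_iff) (use f(2,3) f.zero in auto)
  have "f ` center \<phi> = center \<psi>"
  proof -
    have "x \<in> f ` center \<phi>" if "x \<in> center \<psi>" for x
      using that f(2) center by (metis bij_is_surj imageI surjE)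
    then show ?thesis
      using center by blast
  qed
  then show ?thesis
    using vec.dim_image_eq[OF f(1), of "center \<phi>"] f(2) by (metis bij_is_inj inj_on_subset subset_UNIV)
qed

text \<open>
  Transport of structure along an isomorphism \<open>f\<close> is a linear bijection \<open>G\<close> of the space of laws that
  takes \<open>\<delta>\<^sub>\<phi> g\<close> to \<open>\<delta>\<^sub>\<psi> (f \<circ> g \<circ> f\<inverse>)\<close>, hence one tangent space onto the other.
\<close>

lemma dim_orbit_isomorphic:
  assumes "isomorphic_algebras (*s) \<phi> (*s) (\<psi> :: law4)"
  shows "dim_orbit \<phi> = dim_orbit \<psi>"
proof -
  obtain f where f: "Vector_Spaces.linear (*s) (*s) f" "bij f" "\<And>x y. f (\<phi> x y) = \<psi> (f x) (f y)"
    using assms unfolding isomorphic_algebras_def by blast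
  obtain f' where f': "Vector_Spaces.linear (*s) (*s) f'" "\<And>x. f' (f x) = x" "\<And>x. f (f' x) = x"
  proof -
    have "Vector_Spaces.linear (*s) (*s) (inv_into UNIV f)"
      using f(1,2) bij_module_hom_imp_inv_module_hom
      by (auto simp: Vector_Spaces.linear_def)
    then show ?thesis
      using that f(2) by (simp add: bij_is_inj bij_is_surj surj_f_inv_f)
  qed
  interpret f: Vector_Spaces.linear "(*s)" "(*s)" f by (rule f(1))
  define G :: "law4 \<Rightarrow> law4" where "G \<theta> = (\<lambda>x y. f (\<theta> (f' x) (f' y)))" for \<theta>
  interpret G: Vector_Spaces.linear "\<lambda>c (\<psi> :: law4) x y. c *s \<psi> x y" "\<lambda>c (\<psi> :: law4) x y. c *s \<psi> x y" G
    by unfold_locales (simp_all add: G_def fun_eq_iff f.add f.scale)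
  have inj: "inj G"
  proof (rule injI, intro ext)
    fix \<theta> \<theta>' x y
    assume "G \<theta> = G \<theta>'"
    then have "G \<theta> (f x) (f y) = G \<theta>' (f x) (f y)"
      by simp
    then show "\<theta> x y = \<theta>' x y"
      using f(2) by (simp add: G_def f'(2) bij_is_inj inj_eq)
  qed
  have "f' (\<psi> x y) = \<phi> (f' x) (f' y)" for x y
    by (metis f(3) f'(2,3))
  then have G_delta: "G (delta \<phi> g) = delta \<psi> (f \<circ> g \<circ> f')" for g
    by (simp add: G_def delta_def fun_eq_iff f.add f.diff f(3) f')
  have "G ` orbit_tangent_space \<phi> = orbit_tangent_space \<psi>"
  proof (intro subset_antisym subsetI)
    fix \<theta>
    assume "\<theta> \<in> G ` orbit_tangent_space \<phi>"
    then obtain g where "Vector_Spaces.linear (*s) (*s) g" "\<theta> = delta \<psi> (f \<circ> g \<circ> f')"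
      by (auto simp: orbit_tangent_space_def G_delta)
    then show "\<theta> \<in> orbit_tangent_space \<psi>"
      using f(1) f'(1) Vector_Spaces.linear_compose unfolding orbit_tangent_space_def by blast
  next
    fix \<theta>
    assume "\<theta> \<in> orbit_tangent_space \<psi>"
    then obtain h where h: "Vector_Spaces.linear (*s) (*s) h" "\<theta> = delta \<psi> h"
      by (auto simp: orbit_tangent_space_def)
    have "f \<circ> (f' \<circ> h \<circ> f) \<circ> f' = h"
      by (simp add: fun_eq_iff f')
    then have "\<theta> = G (delta \<phi> (f' \<circ> h \<circ> f))"
      by (simp add: G_delta h)
    moreover have "Vector_Spaces.linear (*s) (*s) (f' \<circ> h \<circ> f)"
      using f(1) f'(1) h(1) Vector_Spaces.linear_compose by blast
    ultimately show "\<theta> \<in> G ` orbit_tangent_space \<phi>"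
      unfolding orbit_tangent_space_def by blast
  qed
  moreover have "laws.dim (G ` T) = laws.dim T" for T
  proof -
    obtain B where B: "B \<subseteq> T" "laws.independent B" "T \<subseteq> laws.span B" "card B = laws.dim T"
      using laws.basis_exists[of T] by blast
    show ?thesis
    proof (rule laws.dim_unique)
      show "G ` B \<subseteq> G ` T"
        using B(1) by blast
      show "G ` T \<subseteq> laws.span (G ` B)"
        using B(3) by (simp add: G.span_image image_mono)
      show "laws.independent (G ` B)"
        using B(2) inj by (simp add: G.independent_injective_image inj_on_subset)
      show "card (G ` B) = laws.dim T"
        using B(4) inj by (simp add: card_image inj_on_subset)
    qed
  qed
  ultimately show ?thesis
    unfolding dim_orbit_def by metis
qed

lemma triple_products_zero_isomorphic:
  assumes "isomorphic_algebras (*s) \<phi> (*s) (\<psi> :: law4)" "\<And>x y z. \<phi> (\<phi> x y) z = 0"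
  shows "\<psi> (\<psi> x y) z = 0"
proof -
  obtain f where f: "Vector_Spaces.linear (*s) (*s) f" "\<And>x y. f (\<psi> x y) = \<phi> (f x) (f y)" "bij f"
    using isomorphic_algebras_sym[OF assms(1)] unfolding isomorphic_algebras_def by blast
  interpret f: Vector_Spaces.linear "(*s)" "(*s)" f by (rule f(1))
  have "f (\<psi> (\<psi> x y) z) = f 0"
    by (simp add: f(2) assms(2) f.zero)
  then show ?thesis
    by (rule injD[OF bij_is_inj[OF f(3)]])
qed

lemma quadruple_products_zero_isomorphic:
  assumes "isomorphic_algebras (*s) \<phi> (*s) (\<psi> :: law4)" "\<And>x y z w. \<phi> (\<phi> (\<phi> x y) z) w = 0"
  shows "\<psi> (\<psi> (\<psi> x y) z) w = 0"
proof -
  obtain f where f: "Vector_Spaces.linear (*s) (*s) f" "\<And>x y. f (\<psi> x y) = \<phi> (f x) (f y)" "bij f"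
    using isomorphic_algebras_sym[OF assms(1)] unfolding isomorphic_algebras_def by blast
  interpret f: Vector_Spaces.linear "(*s)" "(*s)" f by (rule f(1))
  have "f (\<psi> (\<psi> (\<psi> x y) z) w) = f 0"
    by (simp add: f(2) assms(2) f.zero)
  then show ?thesis
    by (rule injD[OF bij_is_inj[OF f(3)]])
qed

text \<open>
  Closedness under addition of the vectors with central square tells a square \<open>x\<^sub>1\<^sup>2e\<^sub>2\<close> of rank one
  modulo the center from a square \<open>(x\<^sub>1\<^sup>2 - x\<^sub>4\<^sup>2)e\<^sub>2\<close> of rank two, where the vectors with central square
  form two hyperplanes.
\<close>

lemma central_squares_closed_isomorphic:
  assumes "isomorphic_algebras (*s) \<phi> (*s) (\<psi> :: law4)"
    and closed: "\<And>x y. \<phi> x x \<in> center \<phi> \<Longrightarrow> \<phi> y y \<in> center \<phi> \<Longrightarrow> \<phi> (x + y) (x + y) \<in> center \<phi>"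
    and "\<psi> x x \<in> center \<psi>" "\<psi> y y \<in> center \<psi>"
  shows "\<psi> (x + y) (x + y) \<in> center \<psi>"
proof -
  obtain f where f: "Vector_Spaces.linear (*s) (*s) f" "\<And>x y. f (\<psi> x y) = \<phi> (f x) (f y)" "bij f"
    using isomorphic_algebras_sym[OF assms(1)] unfolding isomorphic_algebras_def by blast
  interpret f: Vector_Spaces.linear "(*s)" "(*s)" f by (rule f(1))
  have "\<phi> (f z) (f z) \<in> center \<phi> \<longleftrightarrow> \<psi> z z \<in> center \<psi>" for z
    unfolding f(2)[symmetric] by (rule isomorphism_center_iff) (use f(2,3) f.zero in auto)
  then show ?thesis
    using closed[of "f x" "f y"] assms(3,4) by (metis f.add)
qed

text \<open>
  These are the pairs with equal orbit dimension and equal dimension of the center.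
\<close>

lemma phi_not_isomorphic_exceptional:
  assumes "(i, j) \<in> {(3, 1), (5, 1), (5, 3), (6, 4), (8, 7)}"
  shows "\<not> isomorphic_algebras (*s) (phi i) (*s) (phi j)"
proof
  assume iso: "isomorphic_algebras (*s) (phi i) (*s) (phi j)"
  consider "i \<in> {3, 5}" "j = 1" | "i = 8" "j = 7" | "i \<in> {5, 6}" "j \<in> {3, 4}"
    using assms by auto
  then show False
  proof cases
    case 1
    then have "phi i (phi i (phi i x y) z) w = 0" for x y z w
      by (auto simp: phi_components vec4_eq_iff)
    from quadruple_products_zero_isomorphic[OF iso this, of "e 1" "e 1" "e 1" "e 1"] show False
      using 1 by (simp add: phi_components vec4_eq_iff)
  next
    case 2
    then have "phi i (phi i x y) z = 0" for x y z
      by (simp add: phi_components vec4_eq_iff)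
    from triple_products_zero_isomorphic[OF iso this, of "e 1" "e 1" "e 1"] show False
      using 2 by (simp add: phi_components vec4_eq_iff)
  next
    case 3
    have central: "phi i x x \<in> center (phi i) \<longleftrightarrow> x $ 1 = 0" for x
      using 3(1) by (auto simp: center_phi phi_components forall_4)
    have "phi j (e 1 + e 4 + (e 1 - e 4)) (e 1 + e 4 + (e 1 - e 4)) \<in> center (phi j)"
    proof (rule central_squares_closed_isomorphic[OF iso])
      show "phi i (x + y) (x + y) \<in> center (phi i)"
        if "phi i x x \<in> center (phi i)" "phi i y y \<in> center (phi i)" for x y
        using that by (simp add: central)
    qed (use 3(2) in \<open>auto simp: center_phi phi_components forall_4\<close>)
    then show False
      using 3(2) by (auto simp: center_phi phi_components forall_4)
  qed
qed

lemma phi_not_isomorphic: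
  assumes i: "i \<in> {1..12}" and j: "j \<in> {1..12}" and "i \<noteq> j"
  shows "\<not> isomorphic_algebras (*s) (phi i) (*s) (phi j)"
proof
  assume iso: "isomorphic_algebras (*s) (phi i) (*s) (phi j)"
  have "dim_orbit (phi i) = dim_orbit (phi j)" "vec.dim (center (phi i)) = vec.dim (center (phi j))"
    using iso by (rule dim_orbit_isomorphic, rule dim_center_isomorphic)
  then have "(i, j) \<in> {(3, 1), (5, 1), (5, 3), (6, 4), (8, 7)} \<or> (j, i) \<in> {(3, 1), (5, 1), (5, 3), (6, 4), (8, 7)}"
    using index_cases[OF i] index_cases[OF j] \<open>i \<noteq> j\<close>
    by (elim disjE) (simp_all add: dim_orbit_phi dim_center_phi)
  then show False
    using phi_not_isomorphic_exceptional iso isomorphic_algebras_sym[OF iso] by blast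
qed

section \<open>The classification\<close>

theorem theorem3p4:
  shows
    "(\<forall>(smul :: complex \<Rightarrow> 'v::ab_group_add \<Rightarrow> 'v) \<phi>.
        nilpotent_jordan_algebra smul \<phi> \<and> vector_space.dim smul UNIV = 4 \<and> \<not> abelian \<phi> \<longrightarrow>
        (\<exists>i\<in>{1..12}. isomorphic_algebras smul \<phi> (*s) (phi i)))
     \<and> (\<forall>i\<in>{1..12}. nilpotent_jordan_algebra (*s) (phi i) \<and> \<not> abelian (phi i))
     \<and> (\<forall>i\<in>{1..12}. \<forall>j\<in>{1..12}. i \<noteq> j \<longrightarrow> \<not> isomorphic_algebras (*s) (phi i) (*s) (phi j))
     \<and> has_char_seq (phi 1) [4] \<and> dim_orbit (phi 1) = 12 \<and> vec.dim (center (phi 1)) = 1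
     \<and> has_char_seq (phi 2) [3, 1] \<and> dim_orbit (phi 2) = 13 \<and> vec.dim (center (phi 2)) = 1
     \<and> has_char_seq (phi 3) [3, 1] \<and> dim_orbit (phi 3) = 12 \<and> vec.dim (center (phi 3)) = 1
     \<and> has_char_seq (phi 4) [3, 1] \<and> dim_orbit (phi 4) = 11 \<and> vec.dim (center (phi 4)) = 1
     \<and> has_char_seq (phi 5) [3, 1] \<and> dim_orbit (phi 5) = 12 \<and> vec.dim (center (phi 5)) = 1
     \<and> has_char_seq (phi 6) [3, 1] \<and> dim_orbit (phi 6) = 11 \<and> vec.dim (center (phi 6)) = 1
     \<and> has_char_seq (phi 7) [3, 1] \<and> dim_orbit (phi 7) = 10 \<and> vec.dim (center (phi 7)) = 2
     \<and> has_char_seq (phi 8) [2, 2] \<and> dim_orbit (phi 8) = 10 \<and> vec.dim (center (phi 8)) = 2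
     \<and> has_char_seq (phi 9) [2, 2] \<and> dim_orbit (phi 9) = 9 \<and> vec.dim (center (phi 9)) = 2
     \<and> has_char_seq (phi 10) [2, 1, 1] \<and> dim_orbit (phi 10) = 9 \<and> vec.dim (center (phi 10)) = 1
     \<and> has_char_seq (phi 11) [2, 1, 1] \<and> dim_orbit (phi 11) = 8 \<and> vec.dim (center (phi 11)) = 2
     \<and> has_char_seq (phi 12) [2, 1, 1] \<and> dim_orbit (phi 12) = 6 \<and> vec.dim (center (phi 12)) = 3"
proof (intro conjI)
  show "\<forall>(smul :: complex \<Rightarrow> 'v \<Rightarrow> 'v) \<phi>.
        nilpotent_jordan_algebra smul \<phi> \<and> vector_space.dim smul UNIV = 4 \<and> \<not> abelian \<phi> \<longrightarrow>
        (\<exists>i\<in>{1..12}. isomorphic_algebras smul \<phi> (*s) (phi i))"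
    using nilpotent_jordan_classified by blast
  show "\<forall>i\<in>{1..12}. nilpotent_jordan_algebra (*s) (phi i) \<and> \<not> abelian (phi i)"
    using phi_nilpotent phi_not_abelian by blast
  show "\<forall>i\<in>{1..12}. \<forall>j\<in>{1..12}. i \<noteq> j \<longrightarrow> \<not> isomorphic_algebras (*s) (phi i) (*s) (phi j)"
    using phi_not_isomorphic by blast
qed (simp_all add: has_char_seq_phi_1 has_char_seq_phi_3_1 has_char_seq_phi_2_2 has_char_seq_phi_2_1_1
    dim_orbit_phi dim_center_phi)

end
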